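(* Let $\xi$ be a subordinator with Laplace exponent $\phi$, let $\Phi(q)=\int_0^q\phi(s)\,\mathrm ds$ for $q\ge 0$, and let $\rho(t)=\inf\{r\ge 0:\int_0^r\xi_u\,\mathrm du>t\}$ for $t\ge 0$. Then for every $q>0$ there exists $a(q)\in(0,\infty)$ such that for all $t\ge 0$ $$\mathbb E\left[e^{-q\xi_{\rho(t)}}\right]\le a(q)\,\bigl(1+t^{1/8}\bigr)\,e^{-2\sqrt{\Phi(q)t}}.$$
   Context: A subordinator here is a càdlàg non-decreasing $[0,\infty]$-valued process with stationary independent increments, possibly killed (sent to the absorbing state $\infty$) at an independent exponential time of rate $\kappa$. The subordinator $\xi$ starts from $\xi_0=0$ and has Laplace exponent $\phi(q)=-\log\mathbb E[e^{-q\xi_1}]=\kappa+cq+\int_0^\infty(1-e^{-qx})\,\pi(\mathrm dx)$, where $\kappa\ge 0$, $c\ge 0$ and $\pi$ is a measure on $(0,\infty)$ with $\int_0^\infty(1\wedge x)\,\pi(\mathrm dx)<\infty$. Standing assumption: $\pi(0,\infty)>0$. Conventions: $\inf\emptyset=\infty$, $e^{-\infty}=0$. *)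

theory Defs
  imports "HOL-Probability.Probability"
begin

(* Processes are indexed by real times; only times t \<ge> 0 are ever constrained or used. *)

definition cadlag_on_nonneg :: "(real \<Rightarrow> 'b::topological_space) \<Rightarrow> bool" where
  "cadlag_on_nonneg f \<longleftrightarrow>
     (\<forall>t\<ge>0. (f \<longlongrightarrow> f t) (at_right t)) \<and>
     (\<forall>t>0. \<exists>l. (f \<longlongrightarrow> l) (at_left t))"

definition stationary_increments :: "'a measure \<Rightarrow> (real \<Rightarrow> 'a \<Rightarrow> real) \<Rightarrow> bool" where
  "stationary_increments M \<eta> \<longleftrightarrow>
     (\<forall>s\<ge>0. \<forall>h\<ge>0. distr M borel (\<lambda>\<omega>. \<eta> (s + h) \<omega> - \<eta> s \<omega>) = distr M borel (\<lambda>\<omega>. \<eta> h \<omega> - \<eta> 0 \<omega>))"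

definition independent_increments :: "'a measure \<Rightarrow> (real \<Rightarrow> 'a \<Rightarrow> real) \<Rightarrow> bool" where
  "independent_increments M \<eta> \<longleftrightarrow>
     (\<forall>(n::nat) (t::nat \<Rightarrow> real). 0 \<le> t 0 \<and> (\<forall>i<n. t i \<le> t (Suc i)) \<longrightarrow>
        prob_space.indep_vars M (\<lambda>_. borel) (\<lambda>i \<omega>. \<eta> (t (Suc i)) \<omega> - \<eta> (t i) \<omega>) {..<n})"

definition unkilled_subordinator :: "'a measure \<Rightarrow> (real \<Rightarrow> 'a \<Rightarrow> real) \<Rightarrow> bool" where
  "unkilled_subordinator M \<eta> \<longleftrightarrow>
     (\<forall>t\<ge>0. \<eta> t \<in> borel_measurable M) \<and>
     (\<forall>\<omega>\<in>space M. \<eta> 0 \<omega> = 0 \<and> mono_on {0..} (\<lambda>t. \<eta> t \<omega>) \<and> cadlag_on_nonneg (\<lambda>t. \<eta> t \<omega>)) \<and>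
     stationary_increments M \<eta> \<and>
     independent_increments M \<eta>"

(* Rate 0 means that the time is almost surely infinite, i.e. no killing takes place. *)

definition exponential_time :: "'a measure \<Rightarrow> real \<Rightarrow> ('a \<Rightarrow> ennreal) \<Rightarrow> bool" where
  "exponential_time M \<kappa> \<zeta> \<longleftrightarrow>
     \<zeta> \<in> borel_measurable M \<and>
     (if \<kappa> = 0 then AE \<omega> in M. \<zeta> \<omega> = \<infinity>
      else (AE \<omega> in M. \<zeta> \<omega> < \<infinity>) \<and>
           distributed M lborel (\<lambda>\<omega>. enn2real (\<zeta> \<omega>)) (exponential_density \<kappa>))"

(* A subordinator with killing rate \<kappa>: sent to the absorbing state \<infinity> at the time \<zeta>. Independence
   of \<zeta> and the whole process \<eta> is independence of the sigma-algebras they generate, \<eta> being seen as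
   a random element of the product space over [0,\<infinity>); indep_var would force equal value types. *)

definition subordinator :: "'a measure \<Rightarrow> real \<Rightarrow> (real \<Rightarrow> 'a \<Rightarrow> ennreal) \<Rightarrow> bool" where
  "subordinator M \<kappa> \<xi> \<longleftrightarrow>
     0 \<le> \<kappa> \<and>
     (\<exists>\<eta> \<zeta>. unkilled_subordinator M \<eta> \<and> exponential_time M \<kappa> \<zeta> \<and>
        prob_space.indep_set M
          (sets (vimage_algebra (space M) \<zeta> borel))
          (sets (vimage_algebra (space M) (\<lambda>\<omega>. \<lambda>t\<in>{0..}. \<eta> t \<omega>) (\<Pi>\<^sub>M t\<in>{0..}. borel))) \<and>
        (\<forall>t\<ge>0. \<forall>\<omega>\<in>space M. \<xi> t \<omega> = (if ennreal t < \<zeta> \<omega> then ennreal (\<eta> t \<omega>) else \<infinity>)))"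

(* e^{-q x} for x in [0,\<infinity>], with e^{-\<infinity>} = 0. The value at x = \<infinity> is 0 also for q = 0, so that
   the Laplace exponent takes the value \<kappa> at 0. *)

definition exp_neg :: "real \<Rightarrow> ennreal \<Rightarrow> real" where
  "exp_neg q x = (if x = \<infinity> then 0 else exp (- q * enn2real x))"

definition laplace_exponent :: "'a measure \<Rightarrow> (real \<Rightarrow> 'a \<Rightarrow> ennreal) \<Rightarrow> real \<Rightarrow> real" where
  "laplace_exponent M \<xi> q = - ln (\<integral>\<omega>. exp_neg q (\<xi> 1 \<omega>) \<partial>M)"

definition subordinator_levy_measure :: "real measure \<Rightarrow> bool" where
  "subordinator_levy_measure \<pi> \<longleftrightarrow>
     sets \<pi> = sets (restrict_space borel {0<..}) \<and>
     (\<integral>\<^sup>+x. ennreal (min 1 x) \<partial>\<pi>) < \<infinity>"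

definition integrated_exponent :: "(real \<Rightarrow> real) \<Rightarrow> real \<Rightarrow> real" where
  "integrated_exponent \<phi> q = integral {0..q} \<phi>"

(* Infimum in [0,\<infinity>], so the infimum of the empty set is \<infinity>. *)

definition time_change :: "(real \<Rightarrow> 'a \<Rightarrow> ennreal) \<Rightarrow> real \<Rightarrow> 'a \<Rightarrow> ennreal" where
  "time_change \<xi> t \<omega> =
     Inf {ennreal r | r. 0 \<le> r \<and> ennreal t < (\<integral>\<^sup>+u\<in>{0..r}. \<xi> u \<omega> \<partial>lborel)}"

(* Value of a non-decreasing process at a random time in [0,\<infinity>]; its value at time \<infinity> is its limit. *)

definition value_at :: "(real \<Rightarrow> 'a \<Rightarrow> ennreal) \<Rightarrow> ('a \<Rightarrow> ennreal) \<Rightarrow> 'a \<Rightarrow> ennreal" where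
  "value_at \<xi> \<tau> \<omega> = (if \<tau> \<omega> = \<infinity> then (SUP r\<in>{0..}. \<xi> r \<omega>) else \<xi> (enn2real (\<tau> \<omega>)) \<omega>)"

end

theory Submission
  imports Defs
begin

text \<open>Write \<open>\<Phi>\<close> for the integrated exponent. For each \<open>\<mu> > 0\<close>, the exponential of
  \<open>- \<mu> r \<xi>\<^sub>r + \<mu> \<integral>\<^sub>0\<^sup>r \<xi>\<^sub>u du + \<Phi>(\<mu> r) / \<mu>\<close> is a martingale in \<open>r\<close>, because the first two terms are the
  integral of \<open>- \<mu> u\<close> against \<open>d\<xi>\<^sub>u\<close>. Stopping at \<open>R = \<rho>(t)\<close> gives
  \<open>E exp (\<mu> t - \<mu> R \<xi>\<^sub>R + \<Phi>(\<mu> R) / \<mu>) \<le> 1\<close>. For \<open>\<mu> = q / R\<close> the exponent would be at least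
  \<open>- q \<xi>\<^sub>R + 2 sqrt (\<Phi>(q) t)\<close>, which is the claim, but \<open>R\<close> is random. So one puts
  \<open>\<mu> = 1 / y\<^sup>2\<close> and integrates against the weight \<open>exp (- \<Phi>(q) y\<^sup>2 - t / y\<^sup>2) dy\<close>, whose mass is at most
  a constant times \<open>exp (- 2 sqrt (\<Phi>(q) t))\<close>. The dependence of the integrand on \<open>t\<close> cancels, and
  \<open>\<Phi>(s) - \<Phi>(q) \<ge> \<phi>(q) (s - q)\<close> shows that the integral over \<open>y\<close> is at least a constant times
  \<open>exp (- q \<xi>\<^sub>R)\<close> as soon as \<open>R \<ge> 1\<close>. If \<open>R < 1\<close>, then \<open>t \<le> R \<xi>\<^sub>R\<close> by monotonicity, so that
  \<open>exp (- q \<xi>\<^sub>R) \<le> exp (- q t)\<close>, which is at most \<open>exp (\<Phi>(q) / q - 2 sqrt (\<Phi>(q) t))\<close>.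

  All inequalities survive exactly when \<open>R\<close> is replaced by the first point of the grid of mesh \<open>1 / n\<close>
  at which the left Riemann sum of \<open>\<xi>\<close> exceeds \<open>t\<close>. Hence stopping is only needed in discrete
  time, and Fatou's lemma with right continuity gives the limit \<open>n \<rightarrow> \<infinity>\<close>.\<close>

section \<open>Integral estimates and optional stopping of product martingales\<close>

text \<open>With \<open>t = b * z ^ 4\<close>, completing the square turns the exponent into
  \<open>- b * (y - z\<^sup>2 / y)\<^sup>2 - 2 * b * z\<^sup>2\<close>, and
  \<open>y - z\<^sup>2 / y = (y - z) * (1 + z / y)\<close> is at least as large as
  \<open>y - z\<close> in absolute value. So a multiple of a normal density with mean
  \<open>z\<close> dominates the integrand.\<close>

lemma nn_integral_exp_square_inverse_square_le:
  fixes b t :: real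
  assumes "0 < b" "0 \<le> t"
  shows "(\<integral>\<^sup>+y. ennreal (exp (- (b * y\<^sup>2) - t / y\<^sup>2)) * indicator {0<..} y \<partial>lborel)
    \<le> ennreal (sqrt (pi / b) * exp (- 2 * sqrt (b * t)))"
proof -
  define z where "z = sqrt (sqrt (t / b))"
  have z: "0 \<le> z" "t = b * (z\<^sup>2)\<^sup>2"
    using assms by (auto simp: z_def)
  have sq: "sqrt (b * t) = b * z\<^sup>2"
    using assms real_sqrt_unique[of "b * z\<^sup>2" "b * t"] by (simp add: z(2) power2_eq_square mult_ac)
  let ?C = "sqrt (pi / b) * exp (- 2 * sqrt (b * t))"
  have le: "exp (- (b * y\<^sup>2) - t / y\<^sup>2) \<le> ?C * normal_density z (1 / sqrt (2 * b)) y"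
    if "0 < y" for y
  proof -
    have "(y - z)\<^sup>2 * 1 \<le> (y - z)\<^sup>2 * (1 + z / y)\<^sup>2"
      using that z(1) by (intro mult_left_mono) auto
    also have "\<dots> = (y - z\<^sup>2 / y)\<^sup>2"
      using that by (simp add: field_simps power2_eq_square)
    also have "\<dots> = y\<^sup>2 + (z\<^sup>2)\<^sup>2 / y\<^sup>2 - 2 * z\<^sup>2"
      using that by (simp add: field_simps power2_eq_square)
    finally have "b * ((y - z)\<^sup>2 + 2 * z\<^sup>2) \<le> b * (y\<^sup>2 + (z\<^sup>2)\<^sup>2 / y\<^sup>2)"
      using assms by (intro mult_left_mono) auto
    then have "- (b * y\<^sup>2) - t / y\<^sup>2 \<le> - 2 * (b * z\<^sup>2) + - (b * (y - z)\<^sup>2)"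
      by (simp add: z(2) algebra_simps)
    then have "exp (- (b * y\<^sup>2) - t / y\<^sup>2) \<le> exp (- 2 * (b * z\<^sup>2)) * exp (- (b * (y - z)\<^sup>2))"
      by (simp add: exp_add[symmetric])
    also have "\<dots> = ?C * normal_density z (1 / sqrt (2 * b)) y"
      using assms by (simp add: normal_density_def sq power_divide real_sqrt_divide power_mult_distrib
          real_sqrt_mult[of 2] real_sqrt_mult[of pi] real_sqrt_mult[of "2 * pi"] algebra_simps del: real_sqrt_mult)
    finally show ?thesis .
  qed
  have "(\<integral>\<^sup>+y. ennreal (exp (- (b * y\<^sup>2) - t / y\<^sup>2)) * indicator {0<..} y \<partial>lborel)
      \<le> (\<integral>\<^sup>+y. ennreal (?C * normal_density z (1 / sqrt (2 * b)) y) \<partial>lborel)"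
  proof (intro nn_integral_mono)
    fix y :: real
    show "ennreal (exp (- (b * y\<^sup>2) - t / y\<^sup>2)) * indicator {0<..} y
        \<le> ennreal (?C * normal_density z (1 / sqrt (2 * b)) y)"
      using ennreal_leI[OF le[of y]] by (cases "0 < y") simp_all
  qed
  also have "\<dots> = ennreal (\<integral>y. ?C * normal_density z (1 / sqrt (2 * b)) y \<partial>lborel)"
    using assms by (intro nn_integral_eq_integral) auto
  also have "\<dots> = ennreal ?C"
    using assms by simp
  finally show ?thesis .
qed

text \<open>With \<open>y = sqrt (R / q) * u\<close> the exponent is \<open>- q x / u\<^sup>2 + p R (1 - u\<^sup>2)\<close>. According to the sign
  of its derivative at \<open>u = 1\<close>, it is at least \<open>- q x - p R (u - 1 / u)\<^sup>2\<close> for all \<open>u \<ge> 1\<close> or for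
  all \<open>u \<le> 1\<close>.\<close>

lemma exp_le_nn_integral_window:
  fixes q R x p :: real
  assumes q: "0 < q" and R: "1 \<le> R" and x: "0 \<le> x" and p: "0 \<le> p"
  shows "ennreal (exp (- q * x)) \<le> ennreal (2 * sqrt q * exp (9 * p / 4)) *
    (\<integral>\<^sup>+y. ennreal (exp (- (R * x / y\<^sup>2) + p * (R - q * y\<^sup>2))) * indicator {0<..} y \<partial>lborel)"
proof -
  \<comment> \<open>\<open>z\<close> is the \<open>y\<close> with \<open>R = q * y\<^sup>2\<close>,
    where \<open>1 / y\<^sup>2\<close> is the ideal parameter \<open>q / R\<close>. The relative
    width \<open>d\<close> gives a window of length \<open>z * d = 1 / (2 * sqrt q)\<close>, free of
    \<open>R\<close>, and \<open>R \<ge> 1\<close> ensures \<open>d \<le> 1 / 2\<close>.\<close>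
  define z d where "z = sqrt (R / q)" and "d = 1 / (2 * sqrt R)"
  have z: "0 < z" "z\<^sup>2 = R / q"
    using q R by (auto simp: z_def)
  have d: "0 < d" "d \<le> 1 / 2" "d\<^sup>2 = 1 / (4 * R)"
    using R by (auto simp: d_def field_simps power2_eq_square)
  \<comment> \<open>The side of \<open>z\<close> is chosen so that
    \<open>(q * x - p * R) * (1 - 1 / u\<^sup>2)\<close> is nonnegative; this is \<open>ineq\<close>
    below.\<close>
  define I :: "real set" where "I = (if p * R \<le> q * x then {z..z * (1 + d)} else {z * (1 - d)..z})"
  have I: "- q * x - 9 * p / 4 \<le> - (R * x / y\<^sup>2) + p * (R - q * y\<^sup>2)" "0 < y" if "y \<in> I" for y
  proof -
    define u where "u = y / z"
    have y: "y = z * u"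
      using z by (simp add: u_def)
    have u: "\<bar>u - 1\<bar> \<le> d" "p * R \<le> q * x \<Longrightarrow> 1 \<le> u" "\<not> p * R \<le> q * x \<Longrightarrow> u \<le> 1"
      using that z(1) d unfolding I_def u_def by (auto simp: field_simps abs_if split: if_splits)
    have "1 / 2 \<le> u"
      using u(1) d(2) by linarith
    then have u0: "1 / 2 \<le> u" "0 < u"
      by auto
    then show "0 < y"
      using y z by simp
    have exponent: "- (R * x / y\<^sup>2) + p * (R - q * y\<^sup>2) = - (q * x) * (1 / u\<^sup>2) + p * R * (1 - u\<^sup>2)"
      using q R u0 by (simp add: y power_mult_distrib z(2) field_simps)
    have ineq: "(p * R) * (1 - 1 / u\<^sup>2) \<le> (q * x) * (1 - 1 / u\<^sup>2)"
    proof (cases "p * R \<le> q * x")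
      case True
      then have "1 / u\<^sup>2 \<le> 1"
        using u(2) by (simp add: field_simps)
      then show ?thesis
        using True by (intro mult_right_mono) auto
    next
      case False
      then have "u\<^sup>2 \<le> 1"
        using u(3) u0 by (simp add: power_le_one)
      then have "1 - 1 / u\<^sup>2 \<le> 0"
        using u0 by (simp add: field_simps)
      then show ?thesis
        using False by (intro mult_right_mono_neg) auto
    qed
    \<comment> \<open>Since \<open>1 / u \<le> 2\<close>, the second factor contributes at most 9,
      and \<open>d\<^sup>2 = 1 / (4 * R)\<close> cancels the factor \<open>R\<close>. This is the
      origin of \<open>9 * p / 4\<close>.\<close>
    have "(u - 1 / u)\<^sup>2 = (u - 1)\<^sup>2 * (1 + 1 / u)\<^sup>2"
      using u0 by (simp add: field_simps power2_eq_square)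
    also have "\<dots> \<le> d\<^sup>2 * 3\<^sup>2"
    proof (intro mult_mono)
      show "(u - 1)\<^sup>2 \<le> d\<^sup>2"
        using u(1) power_mono[of "\<bar>u - 1\<bar>" d 2] by simp
      have "1 + 1 / u \<le> 3"
        using u0 by (simp add: field_simps)
      then show "(1 + 1 / u)\<^sup>2 \<le> 3\<^sup>2"
        using u0 by (intro power_mono) auto
    qed auto
    finally have "(p * R) * (u - 1 / u)\<^sup>2 \<le> (p * R) * (9 / (4 * R))"
      using p R by (intro mult_left_mono) (auto simp: d(3))
    moreover have "(p * R) * (u - 1 / u)\<^sup>2 = - (p * R) * (1 - 1 / u\<^sup>2) - p * R * (1 - u\<^sup>2)"
      using u0 by (simp add: field_simps power2_eq_square)
    moreover have "(p * R) * (9 / (4 * R)) = 9 * p / 4"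
      using R by simp
    \<comment> \<open>The three preceding facts combine linearly once their nonlinear terms are
      abstracted to variables.\<close>
    moreover have "- m \<le> K * v + K * w" if "K * s \<le> n" "K * s = - K * v - K * w" "n = m" for K s v w m n :: real
      using that by linarith
    ultimately have "- (9 * p / 4) \<le> (p * R) * (1 - 1 / u\<^sup>2) + p * R * (1 - u\<^sup>2)"
      by blast
    also have "\<dots> \<le> (q * x) * (1 - 1 / u\<^sup>2) + p * R * (1 - u\<^sup>2)"
      using ineq by simp
    finally show "- q * x - 9 * p / 4 \<le> - (R * x / y\<^sup>2) + p * (R - q * y\<^sup>2)"
      unfolding exponent by (simp add: algebra_simps)
  qed
  have [measurable]: "I \<in> sets lborel"
    by (simp add: I_def)
  have "z * d = 1 / (2 * sqrt q)"
    using R q by (simp add: z_def d_def real_sqrt_divide)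
  then have len: "emeasure lborel I = ennreal (1 / (2 * sqrt q))"
    using z d q by (simp add: I_def algebra_simps)
  \<comment> \<open>\<open>?c\<close> is the reciprocal of the window length times
    \<open>exp (- 9 * p / 4)\<close>.\<close>
  let ?c = "2 * sqrt q * exp (9 * p / 4)"
  have "ennreal (exp (- q * x)) = ennreal ?c * (ennreal (exp (- q * x - 9 * p / 4)) * ennreal (1 / (2 * sqrt q)))"
  proof -
    have "exp (- q * x) = ?c * (exp (- q * x - 9 * p / 4) * (1 / (2 * sqrt q)))"
      using q by (simp add: field_simps exp_add[symmetric])
    then show ?thesis
      using q by (subst ennreal_mult[symmetric] | simp)+
  qed
  also have "\<dots> = ennreal ?c * (\<integral>\<^sup>+y. ennreal (exp (- q * x - 9 * p / 4)) * indicator I y \<partial>lborel)"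
    by (subst nn_integral_cmult_indicator) (measurable, simp add: len)
  also have "\<dots> \<le> ennreal ?c *
    (\<integral>\<^sup>+y. ennreal (exp (- (R * x / y\<^sup>2) + p * (R - q * y\<^sup>2))) * indicator {0<..} y \<partial>lborel)"
    by (intro mult_left_mono nn_integral_mono)
      (auto simp: indicator_def intro!: ennreal_leI I dest: I(1))
  finally show ?thesis .
qed

section \<open>Convexity and measurability of the integrated exponent\<close>

lemma integrated_exponent_diff_bounds:
  fixes \<phi> :: "real \<Rightarrow> real"
  assumes mono: "mono_on {0..} \<phi>" and ab: "0 \<le> a" "a \<le> b"
  shows "(b - a) * \<phi> a \<le> integrated_exponent \<phi> b - integrated_exponent \<phi> a"
    and "integrated_exponent \<phi> b - integrated_exponent \<phi> a \<le> (b - a) * \<phi> b"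
proof -
  have int: "\<phi> integrable_on {u..v}" if "0 \<le> u" for u v
    by (rule integrable_on_mono_on, rule mono_on_subset[OF mono]) (use that in auto)
  have diff: "integrated_exponent \<phi> b - integrated_exponent \<phi> a = integral {a..b} \<phi>"
    using Henstock_Kurzweil_Integration.integral_combine[of 0 a b \<phi>] int ab
    by (simp add: integrated_exponent_def)
  have "integral {a..b} (\<lambda>_. \<phi> a) \<le> integral {a..b} \<phi>"
    using ab by (intro integral_le int integrable_const_ivl) (simp_all add: mono_onD[OF mono])
  then show "(b - a) * \<phi> a \<le> integrated_exponent \<phi> b - integrated_exponent \<phi> a"
    using ab by (simp add: diff)
  have "integral {a..b} \<phi> \<le> integral {a..b} (\<lambda>_. \<phi> b)"
    using ab by (intro integral_le int integrable_const_ivl) (simp_all add: mono_onD[OF mono])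
  then show "integrated_exponent \<phi> b - integrated_exponent \<phi> a \<le> (b - a) * \<phi> b"
    using ab by (simp add: diff)
qed

text \<open>The integral of a monotone \<open>\<phi>\<close> is convex and \<open>\<phi> q\<close>
  is a subgradient at \<open>q\<close>. The two endpoint bounds treat \<open>s\<close> to the right
  and to the left of \<open>q\<close>.\<close>

lemma integrated_exponent_tangent:
  fixes \<phi> :: "real \<Rightarrow> real"
  assumes "mono_on {0..} \<phi>" "0 \<le> s" "0 \<le> q"
  shows "\<phi> q * (s - q) \<le> integrated_exponent \<phi> s - integrated_exponent \<phi> q"
proof (cases "q \<le> s")
  case True
  then show ?thesis
    using integrated_exponent_diff_bounds(1)[OF assms(1), of q s] assms by (simp add: mult.commute)
next
  case False
  have "(q - s) * \<phi> q = - (\<phi> q * (s - q))"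
    by (simp add: algebra_simps)
  then show ?thesis
    using False integrated_exponent_diff_bounds(2)[OF assms(1), of s q] assms by simp
qed

text \<open>Right endpoints bound a monotone function from above on each cell. They are also the
  points at which the factors of the grid martingale evaluate the exponent.\<close>

lemma integrated_exponent_le_riemann_sum:
  fixes \<phi> :: "real \<Rightarrow> real"
  assumes mono: "mono_on {0..} \<phi>" and d: "0 \<le> d"
  shows "integrated_exponent \<phi> (real k * d) \<le> (\<Sum>i<k. d * \<phi> (real (Suc i) * d))"
proof (induction k)
  case 0
  then show ?case by (simp add: integrated_exponent_def)
next
  case (Suc k)
  have "integrated_exponent \<phi> (real (Suc k) * d) - integrated_exponent \<phi> (real k * d)
      \<le> (real (Suc k) * d - real k * d) * \<phi> (real (Suc k) * d)"
    using d by (intro integrated_exponent_diff_bounds[OF mono]) (auto intro!: mult_right_mono)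
  also have "\<dots> = d * \<phi> (real (Suc k) * d)"
    by (simp add: algebra_simps)
  finally show ?case
    using Suc by simp
qed

text \<open>The function is monotone on the whole line: it is 0 at negative arguments, where the
  interval of integration is empty, and \<open>\<phi>\<close> is nonnegative on the rest.\<close>

lemma borel_measurable_integrated_exponent:
  fixes \<phi> :: "real \<Rightarrow> real"
  assumes mono: "mono_on {0..} \<phi>" and nonneg: "0 \<le> \<phi> 0"
  shows "integrated_exponent \<phi> \<in> borel_measurable borel"
proof (intro borel_measurable_mono monoI)
  fix a b :: real assume "a \<le> b"
  have nn: "0 \<le> \<phi> x" if "0 \<le> x" for x
    using mono_onD[OF mono, of 0 x] that nonneg by simp
  have "integrated_exponent \<phi> (max 0 a) \<le> integrated_exponent \<phi> (max 0 b)"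
  proof -
    have "0 \<le> (max 0 b - max 0 a) * \<phi> (max 0 a)"
      using \<open>a \<le> b\<close> by (intro mult_nonneg_nonneg nn) auto
    also have "\<dots> \<le> integrated_exponent \<phi> (max 0 b) - integrated_exponent \<phi> (max 0 a)"
      using \<open>a \<le> b\<close> by (intro integrated_exponent_diff_bounds(1)[OF mono]) auto
    finally show ?thesis by simp
  qed
  moreover have "integrated_exponent \<phi> (max 0 x) = integrated_exponent \<phi> x" for x
    by (cases "0 \<le> x") (simp_all add: integrated_exponent_def max_def)
  ultimately show "integrated_exponent \<phi> a \<le> integrated_exponent \<phi> b"
    by simp
qed

section \<open>Optional stopping in discrete time\<close>

context prob_space
begin

lemma indep_var_nn_integral_mult:
  fixes U V :: "'a \<Rightarrow> ennreal"
  assumes "indep_var borel U borel V"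
  shows "(\<integral>\<^sup>+\<omega>. U \<omega> * V \<omega> \<partial>M) = (\<integral>\<^sup>+\<omega>. U \<omega> \<partial>M) * (\<integral>\<^sup>+\<omega>. V \<omega> \<partial>M)"
proof -
  have "case_bool borel borel = (\<lambda>_. borel :: ennreal measure)"
    by (auto split: bool.split)
  then have "indep_vars (\<lambda>_. borel) (case_bool U V) UNIV"
    using assms by (simp add: indep_var_def)
  then have "(\<integral>\<^sup>+\<omega>. (\<Prod>i\<in>UNIV. case_bool U V i \<omega>) \<partial>M) = (\<Prod>i\<in>UNIV. \<integral>\<^sup>+\<omega>. case_bool U V i \<omega> \<partial>M)"
    by (intro indep_vars_nn_integral) auto
  then show ?thesis
    by (simp add: UNIV_bool mult.commute)
qed

text \<open>\<open>A k\<close> is the event that a stopping time exceeds \<open>k\<close>, as a set of values of the first \<open>k\<close>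
  variables. The left-hand side is the expectation of a nonnegative mean one product martingale at
  this stopping time.\<close>

lemma suminf_stopped_prod_le_1:
  fixes X :: "nat \<Rightarrow> 'a \<Rightarrow> real" and F :: "nat \<Rightarrow> real \<Rightarrow> ennreal" and A :: "nat \<Rightarrow> (nat \<Rightarrow> real) set"
  assumes indep: "\<And>n. indep_vars (\<lambda>_. borel) X {..<n}"
    and F [measurable]: "\<And>i. F i \<in> borel_measurable borel"
    and mean: "\<And>i. (\<integral>\<^sup>+\<omega>. F i (X i \<omega>) \<partial>M) = 1"
    and A: "\<And>k. A k \<in> sets (PiM {..<k} (\<lambda>_. borel))"
    and S: "\<And>k. S k = {\<omega> \<in> space M. restrict (\<lambda>i. X i \<omega>) {..<k} \<in> A k}"
    and anti: "\<And>k. S (Suc k) \<subseteq> S k"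
  shows "(\<Sum>k. \<integral>\<^sup>+\<omega>. indicator (S k - S (Suc k)) \<omega> * (\<Prod>i<Suc k. F i (X i \<omega>)) \<partial>M) \<le> 1"
proof -
  have X [measurable]: "X i \<in> borel_measurable M" for i
    using indep[of "Suc i"] by (auto simp: indep_vars_def2)
  have [measurable]: "S k \<in> sets M" for k
  proof -
    have "(\<lambda>\<omega>. restrict (\<lambda>i. X i \<omega>) {..<k}) \<in> measurable M (PiM {..<k} (\<lambda>_. borel))"
      by (intro measurable_restrict) auto
    from measurable_sets[OF this A] show ?thesis
      unfolding S by (simp add: vimage_def Int_def conj_commute)
  qed
  have step: "(\<integral>\<^sup>+\<omega>. indicator (S k) \<omega> * (\<Prod>i<Suc k. F i (X i \<omega>)) \<partial>M)
      = (\<integral>\<^sup>+\<omega>. indicator (S k) \<omega> * (\<Prod>i<k. F i (X i \<omega>)) \<partial>M)" for k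
  proof -
    have "indep_var (PiM {..<k} (\<lambda>_. borel)) (\<lambda>\<omega>. restrict (\<lambda>i. X i \<omega>) {..<k})
        (PiM {k} (\<lambda>_. borel)) (\<lambda>\<omega>. restrict (\<lambda>i. X i \<omega>) {k})"
      by (rule indep_var_restrict[OF indep[of "Suc k"]]) auto
    moreover have "(\<lambda>x. indicator (A k) x * (\<Prod>i<k. F i (x i))) \<in> borel_measurable (PiM {..<k} (\<lambda>_. borel))"
      using A[of k] by measurable
    moreover have "(\<lambda>x. F k (x k)) \<in> borel_measurable (PiM {k} (\<lambda>_. borel))"
      by measurable
    ultimately have "indep_var borel
       ((\<lambda>x. indicator (A k) x * (\<Prod>i<k. F i (x i))) \<circ> (\<lambda>\<omega>. restrict (\<lambda>i. X i \<omega>) {..<k}))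
       borel ((\<lambda>x. F k (x k)) \<circ> (\<lambda>\<omega>. restrict (\<lambda>i. X i \<omega>) {k}))"
      by (rule indep_var_compose)
    from indep_var_nn_integral_mult[OF this]
    have "(\<integral>\<^sup>+\<omega>. indicator (A k) (restrict (\<lambda>i. X i \<omega>) {..<k}) * (\<Prod>i<k. F i (X i \<omega>)) * F k (X k \<omega>) \<partial>M)
        = (\<integral>\<^sup>+\<omega>. indicator (A k) (restrict (\<lambda>i. X i \<omega>) {..<k}) * (\<Prod>i<k. F i (X i \<omega>)) \<partial>M)"
      by (simp add: mean comp_def)
    moreover have "indicator (S k) \<omega> = (indicator (A k) (restrict (\<lambda>i. X i \<omega>) {..<k}) :: ennreal)"
      if "\<omega> \<in> space M" for \<omega>
      using that by (simp add: S indicator_def)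
    ultimately show ?thesis
      by (simp add: mult.assoc cong: nn_integral_cong)
  qed
  have split: "(\<integral>\<^sup>+\<omega>. indicator (S k - S (Suc k)) \<omega> * (\<Prod>i<Suc k. F i (X i \<omega>)) \<partial>M)
      + (\<integral>\<^sup>+\<omega>. indicator (S (Suc k)) \<omega> * (\<Prod>i<Suc k. F i (X i \<omega>)) \<partial>M)
      = (\<integral>\<^sup>+\<omega>. indicator (S k) \<omega> * (\<Prod>i<Suc k. F i (X i \<omega>)) \<partial>M)" for k
  proof -
    have "indicator (S k - S (Suc k)) \<omega> * z + indicator (S (Suc k)) \<omega> * z = indicator (S k) \<omega> * z"
      for \<omega> and z :: ennreal
      using anti[of k] by (cases "\<omega> \<in> S k"; cases "\<omega> \<in> S (Suc k)") auto
    then show ?thesis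
      by (subst nn_integral_add[symmetric]) (simp_all del: prod.lessThan_Suc)
  qed
  \<comment> \<open>Conservation of mass: what has stopped at an index up to \<open>n\<close>, plus
    what is still running at \<open>n\<close>. By \<open>split\<close> and \<open>step\<close> this
    total does not change with \<open>n\<close>.\<close>
  have le: "(\<Sum>k<n. \<integral>\<^sup>+\<omega>. indicator (S k - S (Suc k)) \<omega> * (\<Prod>i<Suc k. F i (X i \<omega>)) \<partial>M)
      + (\<integral>\<^sup>+\<omega>. indicator (S n) \<omega> * (\<Prod>i<n. F i (X i \<omega>)) \<partial>M) \<le> 1" for n
  proof (induction n)
    case 0
    have "(\<integral>\<^sup>+\<omega>. indicator (S 0) \<omega> \<partial>M) \<le> (1 :: ennreal)"
      by (simp add: measure_le_1 emeasure_le_1)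
    then show ?case by simp
  next
    case (Suc n)
    then show ?case
      unfolding sum.lessThan_Suc add.assoc split step .
  qed
  have "(\<Sum>k<n. \<integral>\<^sup>+\<omega>. indicator (S k - S (Suc k)) \<omega> * (\<Prod>i<Suc k. F i (X i \<omega>)) \<partial>M) \<le> 1" for n
    by (rule order_trans[OF _ le[of n]], rule add_increasing2) simp_all
  then show ?thesis
    by (intro suminf_le_const summableI)
qed

end

section \<open>Approximation of the time change on a grid\<close>

definition left_sum :: "(real \<Rightarrow> 'a \<Rightarrow> real) \<Rightarrow> nat \<Rightarrow> nat \<Rightarrow> 'a \<Rightarrow> real" where
  "left_sum \<eta> n k \<omega> = (\<Sum>i<k. \<eta> (real i / real n) \<omega> / real n)"

text \<open>For nonnegative paths the left sums are nondecreasing in \<open>k\<close>, so this is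
  the event that the first index with a sum above \<open>t\<close> exceeds \<open>k\<close>. Level
  \<open>k\<close> minus level \<open>Suc k\<close> then means stopping at index
  \<open>Suc k\<close>, that is at time \<open>Suc k / n\<close>.\<close>

definition below_level :: "'a measure \<Rightarrow> (real \<Rightarrow> 'a \<Rightarrow> real) \<Rightarrow> real \<Rightarrow> nat \<Rightarrow> nat \<Rightarrow> 'a set" where
  "below_level M \<eta> t n k = {\<omega> \<in> space M. left_sum \<eta> n k \<omega> \<le> t}"

text \<open>On each cell the path lies below its value at the right endpoint. Since
  \<open>\<eta> 0 \<omega> = 0\<close>, shifting the index turns the right sum into the left sum
  plus one last term.\<close>

lemma nn_integral_le_left_sum:
  assumes mono: "mono_on {0..} (\<lambda>u. \<eta> u \<omega>)" and zero: "\<eta> 0 \<omega> = 0"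
    and n: "0 < n" and r: "r * real n \<le> real k"
  shows "(\<integral>\<^sup>+u\<in>{0..r}. ennreal (\<eta> u \<omega>) \<partial>lborel)
    \<le> ennreal (left_sum \<eta> n k \<omega> + \<eta> (real k / real n) \<omega> / real n)"
proof -
  have nonneg: "0 \<le> \<eta> u \<omega>" if "0 \<le> u" for u
    using mono_onD[OF mono, of 0 u] that zero by simp
  let ?J = "\<lambda>i. {real i / real n..real (Suc i) / real n}"
  have "ennreal (\<eta> u \<omega>) * indicator {0..r} u
      \<le> (\<Sum>i<k. ennreal (\<eta> (real (Suc i) / real n) \<omega>) * indicator (?J i) u)" for u
  proof (cases "0 < u \<and> u \<le> r")
    case True
    \<comment> \<open>\<open>i\<close> satisfies \<open>i < u * n \<le> i + 1\<close>. The point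
      \<open>u = 0\<close> lies in no such cell and is treated below, where the integrand
      vanishes.\<close>
    define i where "i = nat (\<lceil>u * real n\<rceil>) - 1"
    have pos: "0 < u * real n"
      using True n by simp
    have "real (nat \<lceil>u * real n\<rceil>) = real_of_int \<lceil>u * real n\<rceil>"
      using pos by simp
    moreover have "1 \<le> nat \<lceil>u * real n\<rceil>"
      using pos by linarith
    ultimately have i: "real i = real_of_int \<lceil>u * real n\<rceil> - 1"
      unfolding i_def by (simp add: of_nat_diff)
    then have *: "real i < u * real n" "u * real n \<le> real (Suc i)"
      by linarith+
    have "u * real n \<le> real k"
      using True r mult_right_mono[of u r "real n"] by simp
    with *(1) have "i < k"
      by linarith
    have J: "u \<in> ?J i"
      using * n by (simp add: field_simps)
    have "ennreal (\<eta> u \<omega>) \<le> ennreal (\<eta> (real (Suc i) / real n) \<omega>) * indicator (?J i) u"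
      using J True by (auto intro!: ennreal_leI mono_onD[OF mono])
    also have "\<dots> \<le> (\<Sum>i<k. ennreal (\<eta> (real (Suc i) / real n) \<omega>) * indicator (?J i) u)"
      using \<open>i < k\<close> by (intro member_le_sum[of i _ "\<lambda>i. ennreal (\<eta> (real (Suc i) / real n) \<omega>) * indicator (?J i) u"]) auto
    finally show ?thesis
      using True by simp
  next
    case False
    then have *: "ennreal (\<eta> u \<omega>) * indicator {0..r} u = 0"
      using zero by (cases "u = 0") (auto simp: indicator_def)
    show ?thesis
      unfolding * by (rule zero_le)
  qed
  then have "(\<integral>\<^sup>+u\<in>{0..r}. ennreal (\<eta> u \<omega>) \<partial>lborel)
      \<le> (\<integral>\<^sup>+u. (\<Sum>i<k. ennreal (\<eta> (real (Suc i) / real n) \<omega>) * indicator (?J i) u) \<partial>lborel)"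
    by (intro nn_integral_mono)
  also have "\<dots> = (\<Sum>i<k. ennreal (\<eta> (real (Suc i) / real n) \<omega>) * emeasure lborel (?J i))"
    by (subst nn_integral_sum) (simp_all add: nn_integral_cmult_indicator)
  also have "\<dots> = (\<Sum>i<k. ennreal (\<eta> (real (Suc i) / real n) \<omega> / real n))"
  proof (intro sum.cong refl)
    fix i
    have "emeasure lborel (?J i) = ennreal (1 / real n)"
      using n by (simp add: divide_right_mono diff_divide_distrib[symmetric])
    then show "ennreal (\<eta> (real (Suc i) / real n) \<omega>) * emeasure lborel (?J i)
        = ennreal (\<eta> (real (Suc i) / real n) \<omega> / real n)"
      using nonneg[of "real (Suc i) / real n"] by (simp add: ennreal_mult[symmetric])
  qed
  also have "\<dots> = ennreal (\<Sum>i<k. \<eta> (real (Suc i) / real n) \<omega> / real n)"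
    using nonneg by (intro sum_ennreal) simp
  also have "(\<Sum>i<k. \<eta> (real (Suc i) / real n) \<omega> / real n)
      = left_sum \<eta> n k \<omega> + \<eta> (real k / real n) \<omega> / real n"
    using sum.lessThan_Suc_shift[of "\<lambda>i. \<eta> (real i / real n) \<omega> / real n" k] zero
    by (simp add: left_sum_def)
  finally show ?thesis .
qed

text \<open>The first grid time at which the left Riemann sum exceeds \<open>t\<close> converges from above to the
  time change, which is why right continuity suffices.\<close>

lemma exp_neg_time_change_le_liminf:
  fixes \<eta> :: "real \<Rightarrow> 'a \<Rightarrow> real" and \<xi> :: "real \<Rightarrow> 'a \<Rightarrow> ennreal" and z :: ennreal
  assumes \<omega>: "\<omega> \<in> space M"
    and mono: "mono_on {0..} (\<lambda>u. \<eta> u \<omega>)" and zero: "\<eta> 0 \<omega> = 0"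
    and cadlag: "cadlag_on_nonneg (\<lambda>u. \<eta> u \<omega>)"
    and nonzero: "0 \<le> s" "0 < \<eta> s \<omega>"
    and \<xi>: "\<And>u. 0 \<le> u \<Longrightarrow> \<xi> u \<omega> = (if ennreal u < z then ennreal (\<eta> u \<omega>) else \<infinity>)"
    and t: "0 \<le> t" and q: "0 \<le> q"
  shows "ennreal (exp_neg q (value_at \<xi> (time_change \<xi> t) \<omega>)) \<le>
    liminf (\<lambda>n. \<Sum>k. indicator (below_level M \<eta> t (Suc n) k - below_level M \<eta> t (Suc n) (Suc k)) \<omega> *
      (if ennreal (real (Suc k) / real (Suc n)) < z
       then ennreal (exp (- q * \<eta> (real (Suc k) / real (Suc n)) \<omega>)) else 0))"
    (is "_ \<le> liminf (\<lambda>n. \<Sum>k. ?g n k)")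
proof -
  have nonneg: "0 \<le> \<eta> u \<omega>" if "0 \<le> u" for u
    using mono_onD[OF mono, of 0 u] that zero by simp
  have "time_change \<xi> t \<omega> < \<infinity>"
  proof -
    \<comment> \<open>From time \<open>s\<close> on the path stays above
      \<open>\<eta> s \<omega>\<close>, and \<open>r\<close> is chosen so that this contributes
      \<open>t + 1\<close> to the integral.\<close>
    define r where "r = s + (t + 1) / \<eta> s \<omega>"
    have r: "s \<le> r"
      using nonzero t by (simp add: r_def)
    have "ennreal t < ennreal (t + 1)"
      using t by (simp add: ennreal_less_iff)
    also have "\<dots> = ennreal (\<eta> s \<omega>) * ennreal (r - s)"
      using nonzero t by (simp add: r_def ennreal_mult'[symmetric])
    also have "\<dots> = (\<integral>\<^sup>+u. ennreal (\<eta> s \<omega>) * indicator {s..r} u \<partial>lborel)"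
      using r by (simp add: nn_integral_cmult_indicator)
    also have "\<dots> \<le> (\<integral>\<^sup>+u\<in>{0..r}. \<xi> u \<omega> \<partial>lborel)"
      using nonzero \<xi> by (intro nn_integral_mono)
        (auto simp: indicator_def intro!: ennreal_leI mono_onD[OF mono])
    finally have "time_change \<xi> t \<omega> \<le> ennreal r"
      unfolding time_change_def using r nonzero by (intro Inf_lower) auto
    then show ?thesis
      using order_le_less_trans by fastforce
  qed
  then obtain r0 where r0: "0 \<le> r0" "time_change \<xi> t \<omega> = ennreal r0"
    by (cases "time_change \<xi> t \<omega>") auto
  then have value_at: "value_at \<xi> (time_change \<xi> t) \<omega> = \<xi> r0 \<omega>"
    by (simp add: value_at_def)
  show ?thesis
  proof (cases "ennreal r0 < z")
    \<comment> \<open>Killing has occurred by time \<open>r0\<close>, so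
      \<open>\<xi> r0 \<omega> = \<infinity>\<close> and the left-hand side is 0.\<close>
    case False
    then show ?thesis
      using r0 by (simp add: value_at \<xi> exp_neg_def)
  next
    case True
    have lhs: "exp_neg q (value_at \<xi> (time_change \<xi> t) \<omega>) = exp (- q * \<eta> r0 \<omega>)"
      using True r0 nonneg by (simp add: value_at \<xi> exp_neg_def)
    show ?thesis
      unfolding lhs le_Liminf_iff
    proof (intro allI impI)
      fix y assume y: "y < ennreal (exp (- q * \<eta> r0 \<omega>))"
      have "((\<lambda>u. \<eta> u \<omega>) \<longlongrightarrow> \<eta> r0 \<omega>) (at_right r0)"
        using cadlag r0 by (simp add: cadlag_on_nonneg_def)
      then have "((\<lambda>u. ennreal (exp (- q * \<eta> u \<omega>))) \<longlongrightarrow> ennreal (exp (- q * \<eta> r0 \<omega>))) (at_right r0)"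
        by (intro tendsto_ennrealI tendsto_intros)
      then have "eventually (\<lambda>u. y < ennreal (exp (- q * \<eta> u \<omega>))) (at_right r0)"
        using y by (rule order_tendstoD)
      moreover have "((\<lambda>u. ennreal u) \<longlongrightarrow> ennreal r0) (at_right r0)"
        by (intro tendsto_ennrealI tendsto_intros)
      then have "eventually (\<lambda>u. ennreal u < z) (at_right r0)"
        using True by (rule order_tendstoD)
      moreover have "eventually (\<lambda>u. r0 < u) (at_right r0)"
        by (simp add: eventually_at_right_less)
      ultimately have "eventually (\<lambda>u. y < ennreal (exp (- q * \<eta> u \<omega>)) \<and> ennreal u < z \<and> r0 < u) (at_right r0)"
        by eventually_elim auto
      \<comment> \<open>One point to the right of \<open>r0\<close>, before killing, at which the
        value is still above \<open>y\<close>. By monotonicity every earlier time works as well, so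
        it remains to see that the grid stops by \<open>r2\<close>.\<close>
      then obtain r2 where r2: "y < ennreal (exp (- q * \<eta> r2 \<omega>))" "ennreal r2 < z" "r0 < r2"
        using eventually_happens'[OF trivial_limit_at_right_real] by blast
      have "time_change \<xi> t \<omega> < ennreal r2"
        using r0 r2 by (simp add: ennreal_less_iff)
      then obtain r1 where r1: "0 \<le> r1" "ennreal r1 < ennreal r2"
        "ennreal t < (\<integral>\<^sup>+u\<in>{0..r1}. \<xi> u \<omega> \<partial>lborel)"
        unfolding time_change_def Inf_less_iff by auto
      then have r12: "r1 < r2"
        by (simp add: ennreal_less_iff)
      have "(\<integral>\<^sup>+u\<in>{0..r1}. \<xi> u \<omega> \<partial>lborel) = (\<integral>\<^sup>+u\<in>{0..r1}. ennreal (\<eta> u \<omega>) \<partial>lborel)"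
      proof (intro nn_integral_cong)
        fix u
        have "ennreal u < z" if "u \<le> r1"
          using that r12 r2(2) by (meson ennreal_leI less_imp_le order_le_less_trans order_trans)
        then show "\<xi> u \<omega> * indicator {0..r1} u = ennreal (\<eta> u \<omega>) * indicator {0..r1} u"
          by (auto simp: \<xi> indicator_def)
      qed
      \<comment> \<open>The strict gap between \<open>t\<close> and \<open>b\<close> pays for the
        excess of the integral over the left sum, which is at most
        \<open>\<eta> r2 \<omega> / N\<close>.\<close>
      with r1(3) obtain b where b: "ennreal t < b" "b < (\<integral>\<^sup>+u\<in>{0..r1}. ennreal (\<eta> u \<omega>) \<partial>lborel)"
        by (metis dense)
      then have "b < \<infinity>"
        using order_less_le_trans[OF b(2) top_greatest] by simp
      then obtain a where a: "b = ennreal a" "0 \<le> a"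
        by (cases b) auto
      then have ta: "t < a"
        using b t by (simp add: ennreal_less_iff)
      \<comment> \<open>The first threshold keeps \<open>r1\<close>, rounded up to the grid, below
        \<open>r2\<close>; the second makes the error term smaller than
        \<open>a - t\<close>.\<close>
      have "eventually (\<lambda>n. 1 / (r2 - r1) < real n) sequentially"
        "eventually (\<lambda>n. \<eta> r2 \<omega> / (a - t) < real n) sequentially"
        using filterlim_real_sequentially by (auto simp: filterlim_at_top_dense)
      then show "eventually (\<lambda>n. y < (\<Sum>k. ?g n k)) sequentially"
      proof eventually_elim
        case (elim n)
        define N where "N = real (Suc n)"
        have N: "0 < N" "1 / (r2 - r1) < N" "\<eta> r2 \<omega> / (a - t) < N"
          using elim by (auto simp: N_def)
        define k where "k = nat \<lceil>r1 * N\<rceil>"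
        have k: "r1 * N \<le> real k" "real k < r1 * N + 1"
        proof -
          have "0 \<le> r1 * N"
            using r1 N by simp
          then have "real k = real_of_int \<lceil>r1 * N\<rceil>"
            by (simp add: k_def)
          then show "r1 * N \<le> real k" "real k < r1 * N + 1"
            by linarith+
        qed
        have "1 < (r2 - r1) * N"
          using N r12 by (simp add: field_simps)
        then have "real k < r2 * N"
          using k by (simp add: algebra_simps)
        then have kr2: "real k / N \<le> r2"
          using N by (simp add: field_simps)
        have "ennreal a < ennreal (left_sum \<eta> (Suc n) k \<omega> + \<eta> (real k / real (Suc n)) \<omega> / real (Suc n))"
          using b(2) nn_integral_le_left_sum[where \<eta> = \<eta> and \<omega> = \<omega> and k = k and n = "Suc n" and r = r1, OF mono zero] k(1)
          by (simp add: a N_def)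
        then have "a < left_sum \<eta> (Suc n) k \<omega> + \<eta> (real k / N) \<omega> / N"
          using a(2) by (simp add: ennreal_less_iff N_def)
        also have "\<eta> (real k / N) \<omega> / N \<le> \<eta> r2 \<omega> / N"
          using kr2 N r1 r12 by (intro divide_right_mono mono_onD[OF mono]) auto
        also have "\<eta> r2 \<omega> / N < a - t"
          using N ta by (simp add: field_simps)
        finally have exceed: "t < left_sum \<eta> (Suc n) k \<omega>"
          by simp
        \<comment> \<open>One is subtracted because summand \<open>j\<close> stands for stopping at
          index \<open>Suc j\<close>. The least index is positive, as the empty sum does not exceed
          \<open>t\<close>.\<close>
        define j where "j = (LEAST j. t < left_sum \<eta> (Suc n) j \<omega>) - 1"
        have "0 < (LEAST j. t < left_sum \<eta> (Suc n) j \<omega>)"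
        proof (rule ccontr)
          assume "\<not> ?thesis"
          then have "t < left_sum \<eta> (Suc n) 0 \<omega>"
            using LeastI[of "\<lambda>j. t < left_sum \<eta> (Suc n) j \<omega>", OF exceed] by simp
          then show False
            using t by (simp add: left_sum_def)
        qed
        then have Suc_j: "Suc j = (LEAST j. t < left_sum \<eta> (Suc n) j \<omega>)"
          by (simp add: j_def)
        have j: "t < left_sum \<eta> (Suc n) (Suc j) \<omega>" "left_sum \<eta> (Suc n) j \<omega> \<le> t" "Suc j \<le> k"
          using LeastI[of "\<lambda>j. t < left_sum \<eta> (Suc n) j \<omega>", OF exceed]
            Least_le[of "\<lambda>j. t < left_sum \<eta> (Suc n) j \<omega>", OF exceed]
            not_less_Least[of j "\<lambda>j. t < left_sum \<eta> (Suc n) j \<omega>"]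
          by (auto simp flip: Suc_j)
        have "real (Suc j) / N \<le> real k / N"
          using j(3) N by (intro divide_right_mono) auto
        then have jr2: "real (Suc j) / N \<le> r2"
          using kr2 by simp
        have "y < ennreal (exp (- q * \<eta> r2 \<omega>))"
          by fact
        also have "\<dots> \<le> ennreal (exp (- q * \<eta> (real (Suc j) / N) \<omega>))"
          using jr2 N q r1 r12
          by (intro ennreal_leI) (auto intro!: mult_left_mono mono_onD[OF mono])
        also have "\<dots> = ?g n j"
        proof -
          have "ennreal (real (Suc j) / N) < z"
            using jr2 r2(2) by (meson ennreal_leI order_le_less_trans)
          moreover have "\<omega> \<in> below_level M \<eta> t (Suc n) j - below_level M \<eta> t (Suc n) (Suc j)"
            using \<omega> j by (auto simp: below_level_def)
          ultimately show ?thesis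
            by (simp add: N_def)
        qed
        also have "\<dots> = (\<Sum>k\<in>{j}. ?g n k)"
          by (simp only: sum.insert sum.empty finite.emptyI empty_iff not_False_eq_True add_0_right)
        also have "\<dots> \<le> (\<Sum>k. ?g n k)"
          by (intro sum_le_suminf summableI) auto
        finally show ?case .
      qed
    qed
  qed
qed

section \<open>Increments and killing\<close>

text \<open>Summation by parts, the discrete form of integrating \<open>u\<close> against
  \<open>d\<xi>\<close>. With the weights at right endpoints the correction term is exactly the left
  sum.\<close>

lemma mult_left_sum_increments:
  fixes \<eta> :: "real \<Rightarrow> 'a \<Rightarrow> real"
  assumes "\<eta> 0 \<omega> = 0"
  shows "(\<Sum>i<k. real (Suc i) / real n * (\<eta> (real (Suc i) / real n) \<omega> - \<eta> (real i / real n) \<omega>))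
    = real k / real n * \<eta> (real k / real n) \<omega> - left_sum \<eta> n k \<omega>"
proof (induction k)
  case 0
  then show ?case by (simp add: left_sum_def)
next
  case (Suc k)
  then show ?case
    by (simp add: left_sum_def add_divide_distrib algebra_simps)
qed

text \<open>The second sigma-algebra in \<open>subordinator\<close>, named so that functionals of
  the path can be shown measurable with respect to it.\<close>

definition process_sigma :: "'a measure \<Rightarrow> (real \<Rightarrow> 'a \<Rightarrow> real) \<Rightarrow> 'a measure" where
  "process_sigma M \<eta> = vimage_algebra (space M) (\<lambda>\<omega>. \<lambda>t\<in>{0..}. \<eta> t \<omega>) (\<Pi>\<^sub>M t\<in>{0..}. borel)"

lemma space_process_sigma [simp]: "space (process_sigma M \<eta>) = space M"
  by (simp add: process_sigma_def)

lemma measurable_process_sigma: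
  assumes "0 \<le> s"
  shows "\<eta> s \<in> borel_measurable (process_sigma M \<eta>)"
proof -
  have "(\<lambda>\<omega>. \<lambda>t\<in>{0..}. \<eta> t \<omega>) \<in> measurable (process_sigma M \<eta>) (\<Pi>\<^sub>M t\<in>{0::real..}. (borel :: real measure))"
    unfolding process_sigma_def by (rule measurable_vimage_algebra1) (auto simp: space_PiM)
  moreover have "(\<lambda>x. x s) \<in> measurable (\<Pi>\<^sub>M t\<in>{0::real..}. (borel :: real measure)) borel"
    using assms by (intro measurable_component_singleton) auto
  ultimately have "(\<lambda>\<omega>. (\<lambda>t\<in>{0..}. \<eta> t \<omega>) s) \<in> borel_measurable (process_sigma M \<eta>)"
    by (rule measurable_compose)
  then show ?thesis
    using assms by simp
qed

lemma measurable_left_sum: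
  assumes "\<And>s. 0 \<le> s \<Longrightarrow> \<eta> s \<in> borel_measurable N"
  shows "left_sum \<eta> n k \<in> borel_measurable N"
  unfolding left_sum_def using assms by (intro borel_measurable_sum borel_measurable_divide) auto

lemma sets_below_level:
  assumes "\<And>s. 0 \<le> s \<Longrightarrow> \<eta> s \<in> borel_measurable N" "space N = space M"
  shows "below_level M \<eta> t n k \<in> sets N"
  using measurable_left_sum[OF assms(1)] unfolding below_level_def assms(2)[symmetric]
  by (intro borel_measurable_le) auto

lemma below_level_Suc_subset:
  assumes "\<And>\<omega> s. \<omega> \<in> space M \<Longrightarrow> 0 \<le> s \<Longrightarrow> 0 \<le> \<eta> s \<omega>"
  shows "below_level M \<eta> t n (Suc k) \<subseteq> below_level M \<eta> t n k"
proof
  fix \<omega> assume "\<omega> \<in> below_level M \<eta> t n (Suc k)"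
  moreover have "0 \<le> \<eta> (real k / real n) \<omega> / real n" if "\<omega> \<in> space M"
    using assms[OF that] by simp
  ultimately show "\<omega> \<in> below_level M \<eta> t n k"
    by (auto simp: below_level_def left_sum_def)
qed

lemma unkilled_subordinatorD:
  assumes "unkilled_subordinator M \<eta>"
  shows "0 \<le> s \<Longrightarrow> \<eta> s \<in> borel_measurable M"
    and "\<omega> \<in> space M \<Longrightarrow> \<eta> 0 \<omega> = 0"
    and "\<omega> \<in> space M \<Longrightarrow> mono_on {0..} (\<lambda>t. \<eta> t \<omega>)"
    and "\<omega> \<in> space M \<Longrightarrow> cadlag_on_nonneg (\<lambda>t. \<eta> t \<omega>)"
    and "\<omega> \<in> space M \<Longrightarrow> 0 \<le> s \<Longrightarrow> 0 \<le> \<eta> s \<omega>"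
  using assms mono_onD[of "{0..}" "\<lambda>t. \<eta> t \<omega>" 0 s] by (auto simp: unkilled_subordinator_def)

context prob_space
begin

text \<open>Independence passes to the smaller sigma-algebras generated by
  \<open>indicator A\<close> and by \<open>f\<close>. This serves to split the survival event off a
  functional of the unkilled path.\<close>

lemma indep_set_nn_integral_indicator_mult:
  assumes indep: "indep_set (sets Z) (sets G)"
    and spaces: "space Z = space M" "space G = space M"
    and A: "A \<in> sets Z" and f: "f \<in> borel_measurable G"
  shows "(\<integral>\<^sup>+\<omega>. indicator A \<omega> * f \<omega> \<partial>M) = emeasure M A * (\<integral>\<^sup>+\<omega>. f \<omega> \<partial>M)"
proof -
  have sub: "sets Z \<subseteq> sets M" "sets G \<subseteq> sets M"
    using indep by (auto dest: indep_setD_ev1 indep_setD_ev2)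
  have meas: "h \<in> borel_measurable M" if "h \<in> borel_measurable N" "space N = space M" "sets N \<subseteq> sets M"
    for h :: "'a \<Rightarrow> ennreal" and N
    using measurable_sets[OF that(1)] that(2,3) by (intro measurableI) auto
  have ind: "(indicator A :: 'a \<Rightarrow> ennreal) \<in> borel_measurable Z"
    using A by simp
  have sigma: "sigma_sets (space M) {h -` B \<inter> space M |B. B \<in> sets borel} \<subseteq> sets N"
    if "h \<in> borel_measurable N" "space N = space M" for h :: "'a \<Rightarrow> ennreal" and N
  proof -
    have "{h -` B \<inter> space M |B. B \<in> sets borel} \<subseteq> sets N"
      using measurable_sets[OF that(1)] that(2) by auto
    from sets.sigma_sets_subset[OF this] show ?thesis
      by (simp only: that(2))
  qed
  have "indep_var borel (indicator A :: 'a \<Rightarrow> ennreal) borel f"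
    unfolding indep_var_eq
  proof (intro conjI)
    show "(indicator A :: 'a \<Rightarrow> ennreal) \<in> borel_measurable M"
      by (rule meas[OF ind spaces(1) sub(1)])
    show "f \<in> borel_measurable M"
      by (rule meas[OF f spaces(2) sub(2)])
    show "indep_set (sigma_sets (space M) {indicator A -` B \<inter> space M |B. B \<in> sets (borel :: ennreal measure)})
        (sigma_sets (space M) {f -` B \<inter> space M |B. B \<in> sets borel})"
      unfolding indep_set_def
      by (rule indep_sets_mono_sets[OF indep[unfolded indep_set_def]])
        (simp add: sigma[OF ind spaces(1)] sigma[OF f spaces(2)] split: bool.split)
  qed
  from indep_var_nn_integral_mult[OF this] show ?thesis
    using subsetD[OF sub(1) A] by simp
qed

lemma emeasure_exponential_time_gt:
  assumes \<zeta>: "exponential_time M \<kappa> \<zeta>" and \<kappa>: "0 \<le> \<kappa>" and s: "0 \<le> s"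
  shows "emeasure M {\<omega> \<in> space M. ennreal s < \<zeta> \<omega>} = ennreal (exp (- \<kappa> * s))"
proof (cases "\<kappa> = 0")
  case True
  then have [measurable]: "\<zeta> \<in> borel_measurable M" and "AE \<omega> in M. \<zeta> \<omega> = \<infinity>"
    using \<zeta> by (auto simp: exponential_time_def)
  from this(2) have "AE \<omega> in M. ennreal s < \<zeta> \<omega>"
    by eventually_elim simp
  then show ?thesis
    using True by (subst emeasure_eq_1_AE) auto
next
  case False
  then have [measurable]: "\<zeta> \<in> borel_measurable M" and fin: "AE \<omega> in M. \<zeta> \<omega> < \<infinity>"
    and dist: "distributed M lborel (\<lambda>\<omega>. enn2real (\<zeta> \<omega>)) (exponential_density \<kappa>)"
    using \<zeta> by (auto simp: exponential_time_def)
  \<comment> \<open>The two events agree only almost surely, since \<open>enn2real\<close> sends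
    \<open>\<infinity>\<close> to 0.\<close>
  have "emeasure M {\<omega> \<in> space M. ennreal s < \<zeta> \<omega>} = emeasure M {\<omega> \<in> space M. s < enn2real (\<zeta> \<omega>)}"
  proof (rule emeasure_eq_AE)
    show "AE \<omega> in M. \<omega> \<in> {\<omega> \<in> space M. ennreal s < \<zeta> \<omega>} \<longleftrightarrow> \<omega> \<in> {\<omega> \<in> space M. s < enn2real (\<zeta> \<omega>)}"
      using fin
    proof eventually_elim
      case (elim \<omega>)
      then obtain r where "0 \<le> r" "\<zeta> \<omega> = ennreal r"
        by (cases "\<zeta> \<omega>") auto
      then show ?case
        using s by (simp add: ennreal_less_iff)
    qed
  qed auto
  also have "\<dots> = ennreal (exp (- \<kappa> * s))"
    using exponential_distributedD_gt[OF dist s] \<kappa> False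
    by (simp add: emeasure_eq_measure mult.commute)
  finally show ?thesis .
qed

lemma indep_vars_grid_increments:
  assumes "unkilled_subordinator M \<eta>"
  shows "indep_vars (\<lambda>_. borel)
    (\<lambda>i \<omega>. \<eta> (real (Suc i) / real n) \<omega> - \<eta> (real i / real n) \<omega>) {..<k}"
proof -
  have "independent_increments M \<eta>"
    using assms by (simp add: unkilled_subordinator_def)
  then show ?thesis
    unfolding independent_increments_def
    by (elim allE[of _ k] allE[of _ "\<lambda>i. real i / real n"]) (simp add: divide_right_mono)
qed

text \<open>By stationarity all increments have the same transform \<open>m\<close>. The first
  \<open>n\<close> are independent and add up to \<open>\<eta> 1\<close>, so \<open>m\<close> is the
  nonnegative \<open>n\<close>-th root of \<open>exp (- \<psi>)\<close>.\<close>

lemma nn_integral_exp_grid_increment: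
  assumes sub: "unkilled_subordinator M \<eta>" and n: "0 < n"
    and laplace: "(\<integral>\<^sup>+\<omega>. ennreal (exp (- q * \<eta> 1 \<omega>)) \<partial>M) = ennreal (exp (- \<psi>))"
  shows "(\<integral>\<^sup>+\<omega>. ennreal (exp (- q * (\<eta> (real (Suc i) / real n) \<omega> - \<eta> (real i / real n) \<omega>))) \<partial>M)
    = ennreal (exp (- \<psi> / real n))"
proof -
  note [measurable] = unkilled_subordinatorD(1)[OF sub]
  let ?X = "\<lambda>i \<omega>. \<eta> (real (Suc i) / real n) \<omega> - \<eta> (real i / real n) \<omega>"
  define m where "m = (\<integral>\<^sup>+\<omega>. ennreal (exp (- q * \<eta> (1 / real n) \<omega>)) \<partial>M)"
  have inc: "(\<integral>\<^sup>+\<omega>. ennreal (exp (- q * ?X i \<omega>)) \<partial>M) = m" for i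
  proof -
    have "distr M borel (?X i) = distr M borel (\<lambda>\<omega>. \<eta> (1 / real n) \<omega> - \<eta> 0 \<omega>)"
    proof -
      have "stationary_increments M \<eta>"
        using sub by (simp add: unkilled_subordinator_def)
      then have "distr M borel (\<lambda>\<omega>. \<eta> (real i / real n + 1 / real n) \<omega> - \<eta> (real i / real n) \<omega>)
          = distr M borel (\<lambda>\<omega>. \<eta> (1 / real n) \<omega> - \<eta> 0 \<omega>)"
        unfolding stationary_increments_def by simp
      moreover have "real i / real n + 1 / real n = real (Suc i) / real n"
        by (simp add: add_divide_distrib)
      ultimately show ?thesis
        by simp
    qed
    then have "(\<integral>\<^sup>+x. ennreal (exp (- q * x)) \<partial>distr M borel (?X i))
        = (\<integral>\<^sup>+x. ennreal (exp (- q * x)) \<partial>distr M borel (\<lambda>\<omega>. \<eta> (1 / real n) \<omega> - \<eta> 0 \<omega>))"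
      by simp
    moreover have "?X i \<in> borel_measurable M" "(\<lambda>\<omega>. \<eta> (1 / real n) \<omega> - \<eta> 0 \<omega>) \<in> borel_measurable M"
      by (auto intro!: borel_measurable_diff unkilled_subordinatorD(1)[OF sub])
    ultimately have "(\<integral>\<^sup>+\<omega>. ennreal (exp (- q * ?X i \<omega>)) \<partial>M)
        = (\<integral>\<^sup>+\<omega>. ennreal (exp (- q * (\<eta> (1 / real n) \<omega> - \<eta> 0 \<omega>))) \<partial>M)"
      by (simp add: nn_integral_distr)
    also have "\<dots> = m"
      unfolding m_def using unkilled_subordinatorD(2)[OF sub] by (intro nn_integral_cong) simp
    finally show ?thesis .
  qed
  have "m ^ n = (\<Prod>i<n. \<integral>\<^sup>+\<omega>. ennreal (exp (- q * ?X i \<omega>)) \<partial>M)"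
    by (simp only: inc) simp
  also have "\<dots> = (\<integral>\<^sup>+\<omega>. (\<Prod>i<n. ennreal (exp (- q * ?X i \<omega>))) \<partial>M)"
    by (intro indep_vars_nn_integral[symmetric] indep_vars_compose2[OF indep_vars_grid_increments[OF sub]]) auto
  also have "\<dots> = (\<integral>\<^sup>+\<omega>. ennreal (exp (- q * \<eta> 1 \<omega>)) \<partial>M)"
  proof (intro nn_integral_cong)
    fix \<omega> assume \<omega>: "\<omega> \<in> space M"
    have "(\<Prod>i<n. ennreal (exp (- q * ?X i \<omega>))) = ennreal (exp (- q * (\<Sum>i<n. ?X i \<omega>)))"
      by (simp only: prod_ennreal exp_ge_zero sum_distrib_left exp_sum finite_lessThan)
    also have "(\<Sum>i<n. ?X i \<omega>) = \<eta> 1 \<omega>"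
      using sum_lessThan_telescope[of "\<lambda>i. \<eta> (real i / real n) \<omega>" n] n
        unkilled_subordinatorD(2)[OF sub \<omega>] by simp
    finally show "(\<Prod>i<n. ennreal (exp (- q * ?X i \<omega>))) = ennreal (exp (- q * \<eta> 1 \<omega>))" .
  qed
  finally have mn: "m ^ n = ennreal (exp (- \<psi>))"
    by (simp only: laplace)
  then have "m \<noteq> \<infinity>"
    using n by (auto simp: power_eq_top_ennreal)
  then obtain r where r: "0 \<le> r" "m = ennreal r"
    by (cases m) auto
  then have "r ^ n = exp (- \<psi>)"
    using mn by (simp add: ennreal_power)
  also have "\<dots> = exp (- \<psi> / real n) ^ n"
    using n by (simp add: exp_of_nat_mult[symmetric])
  finally have "r = exp (- \<psi> / real n)"
    using r n power_eq_imp_eq_base[of r n "exp (- \<psi> / real n)"] by simp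
  then show ?thesis
    using inc r by simp
qed

text \<open>If no unit increment is positive, each factor \<open>exp (- X)\<close> is at least 1; by
  independence this has probability at most \<open>exp (- \<psi>) ^ k\<close> for every
  \<open>k\<close>. The result makes the time change almost surely finite.\<close>

lemma AE_subordinator_nonzero:
  assumes sub: "unkilled_subordinator M \<eta>" and \<psi>: "0 < \<psi>"
    and laplace: "(\<integral>\<^sup>+\<omega>. ennreal (exp (- \<eta> 1 \<omega>)) \<partial>M) = ennreal (exp (- \<psi>))"
  shows "AE \<omega> in M. \<exists>s\<ge>0. 0 < \<eta> s \<omega>"
proof -
  let ?X = "\<lambda>i \<omega>. \<eta> (real (Suc i) / real 1) \<omega> - \<eta> (real i / real 1) \<omega>"
  note meas [measurable] = unkilled_subordinatorD(1)[OF sub]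
  have X [measurable]: "?X i \<in> borel_measurable M" for i
    by (auto intro!: borel_measurable_diff meas)
  let ?B = "{\<omega> \<in> space M. \<forall>i. ?X i \<omega> \<le> 0}"
  have B: "?B \<in> sets M"
    by measurable
  have "emeasure M ?B \<le> ennreal (exp (- \<psi>) ^ k)" for k
  proof -
    have "emeasure M ?B = (\<integral>\<^sup>+\<omega>. indicator ?B \<omega> \<partial>M)"
      using B by simp
    also have "\<dots> \<le> (\<integral>\<^sup>+\<omega>. (\<Prod>i<k. ennreal (exp (- 1 * ?X i \<omega>))) \<partial>M)"
    proof (intro nn_integral_mono)
      fix \<omega>
      have "1 \<le> (\<Prod>i<k. ennreal (exp (- 1 * ?X i \<omega>)))" if "\<omega> \<in> ?B"
        using that by (intro prod_ge_1) (auto simp: ennreal_ge_1)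
      then show "indicator ?B \<omega> \<le> (\<Prod>i<k. ennreal (exp (- 1 * ?X i \<omega>)))"
        by (cases "\<omega> \<in> ?B") (simp_all del: mem_Collect_eq)
    qed
    also have "\<dots> = (\<Prod>i<k. \<integral>\<^sup>+\<omega>. ennreal (exp (- 1 * ?X i \<omega>)) \<partial>M)"
      by (intro indep_vars_nn_integral indep_vars_compose2[OF indep_vars_grid_increments[OF sub]]) auto
    also have "\<dots> = (\<Prod>i<k. ennreal (exp (- \<psi> / real 1)))"
      using laplace by (intro prod.cong refl nn_integral_exp_grid_increment[OF sub]) auto
    also have "\<dots> = ennreal (exp (- \<psi>) ^ k)"
      by (simp add: ennreal_power)
    finally show ?thesis .
  qed
  moreover have "(\<lambda>k. ennreal (exp (- \<psi>) ^ k)) \<longlonglongrightarrow> ennreal 0"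
    using \<psi> by (intro tendsto_ennrealI LIMSEQ_realpow_zero) auto
  ultimately have "emeasure M ?B \<le> ennreal 0"
    by (intro LIMSEQ_le_const) auto
  then have "AE \<omega> in M. \<omega> \<notin> ?B"
    using B by (intro AE_not_in) (simp add: null_sets_def)
  then show ?thesis
  proof (rule AE_mp, intro AE_I2 impI)
    fix \<omega> assume \<omega>: "\<omega> \<in> space M" "\<omega> \<notin> ?B"
    then obtain i where "0 < ?X i \<omega>"
      by (auto simp: not_le)
    moreover have "0 \<le> \<eta> (real i / real 1) \<omega>"
      using \<omega> by (intro unkilled_subordinatorD(5)[OF sub]) auto
    ultimately show "\<exists>s\<ge>0. 0 < \<eta> s \<omega>"
      by (intro exI[of _ "real (Suc i) / real 1"]) auto
  qed
qed

text \<open>Tilting increment \<open>i\<close> by \<open>\<mu> * (i + 1) / n\<close> and normalising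
  gives factors of mean one. Their exponents are summed by parts, and at the stopping index the left
  sum exceeds \<open>t\<close>.\<close>

lemma suminf_stopped_grid_le_1:
  assumes sub: "unkilled_subordinator M \<eta>" and n: "0 < n" and \<mu>: "0 \<le> \<mu>"
    and laplace: "\<And>q. 0 \<le> q \<Longrightarrow> (\<integral>\<^sup>+\<omega>. ennreal (exp (- q * \<eta> 1 \<omega>)) \<partial>M) = ennreal (exp (- \<psi> q))"
  shows "(\<Sum>k. \<integral>\<^sup>+\<omega>. indicator (below_level M \<eta> t n k - below_level M \<eta> t n (Suc k)) \<omega> *
      ennreal (exp (\<mu> * t - \<mu> * (real (Suc k) / real n * \<eta> (real (Suc k) / real n) \<omega>) +
        (\<Sum>i<Suc k. \<psi> (\<mu> * (real (Suc i) / real n)) / real n))) \<partial>M) \<le> 1"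
proof -
  note meas = unkilled_subordinatorD(1)[OF sub]
  let ?X = "\<lambda>i \<omega>. \<eta> (real (Suc i) / real n) \<omega> - \<eta> (real i / real n) \<omega>"
  let ?B = "below_level M \<eta> t n"
  define F where "F i x = ennreal (exp (- (\<mu> * (real (Suc i) / real n)) * x) *
      exp (\<psi> (\<mu> * (real (Suc i) / real n)) / real n))" for i x
  \<comment> \<open>The inner sum telescopes to \<open>\<eta> (i / n)\<close>, so this expresses
    \<open>below_level\<close> through the first \<open>k\<close> increments, as optional stopping
    requires.\<close>
  let ?A = "\<lambda>k :: nat. {x \<in> space (\<Pi>\<^sub>M i\<in>{..<k}. borel). (\<Sum>i<k. (\<Sum>j<i. x j) / real n) \<le> t}"
  have stopped: "(\<Sum>k. \<integral>\<^sup>+\<omega>. indicator (?B k - ?B (Suc k)) \<omega> * (\<Prod>i<Suc k. F i (?X i \<omega>)) \<partial>M) \<le> 1"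
  proof (rule suminf_stopped_prod_le_1[where A = ?A])
    show "indep_vars (\<lambda>_. borel) ?X {..<k}" for k
      by (rule indep_vars_grid_increments[OF sub])
    show "F i \<in> borel_measurable borel" for i
      unfolding F_def by measurable
    show "(\<integral>\<^sup>+\<omega>. F i (?X i \<omega>) \<partial>M) = 1" for i
    proof -
      let ?m = "\<mu> * (real (Suc i) / real n)"
      have [measurable]: "?X i \<in> borel_measurable M"
        by (auto intro!: borel_measurable_diff meas)
      have "(\<integral>\<^sup>+\<omega>. F i (?X i \<omega>) \<partial>M)
          = (\<integral>\<^sup>+\<omega>. ennreal (exp (- ?m * ?X i \<omega>)) * ennreal (exp (\<psi> ?m / real n)) \<partial>M)"
        unfolding F_def by (simp only: ennreal_mult exp_ge_zero)
      also have "\<dots> = (\<integral>\<^sup>+\<omega>. ennreal (exp (- ?m * ?X i \<omega>)) \<partial>M) * ennreal (exp (\<psi> ?m / real n))"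
        by (rule nn_integral_multc) measurable
      also have "(\<integral>\<^sup>+\<omega>. ennreal (exp (- ?m * ?X i \<omega>)) \<partial>M) = ennreal (exp (- \<psi> ?m / real n))"
        using \<mu> n by (intro nn_integral_exp_grid_increment[OF sub] laplace) auto
      also have "ennreal (exp (- \<psi> ?m / real n)) * ennreal (exp (\<psi> ?m / real n)) = 1"
        by (simp only: ennreal_mult[symmetric] exp_ge_zero exp_add[symmetric]) simp
      finally show ?thesis .
    qed
    show "?A k \<in> sets (\<Pi>\<^sub>M i\<in>{..<k}. borel)" for k
    proof -
      have "(\<lambda>x. \<Sum>i<k. (\<Sum>j<i. x j) / real n) \<in> borel_measurable (\<Pi>\<^sub>M i\<in>{..<k}. (borel :: real measure))"
        by (intro borel_measurable_sum borel_measurable_divide borel_measurable_const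
            measurable_component_singleton) (auto intro: less_trans)
      then show ?thesis
        by (intro borel_measurable_le) auto
    qed
    show "?B k = {\<omega> \<in> space M. restrict (\<lambda>i. ?X i \<omega>) {..<k} \<in> ?A k}" for k
    proof -
      have "(\<Sum>i<k. (\<Sum>j<i. restrict (\<lambda>i. ?X i \<omega>) {..<k} j) / real n) = left_sum \<eta> n k \<omega>"
        if "\<omega> \<in> space M" for \<omega>
      proof -
        have "(\<Sum>j<i. restrict (\<lambda>i. ?X i \<omega>) {..<k} j) = \<eta> (real i / real n) \<omega>" if "i < k" for i
        proof -
          have "(\<Sum>j<i. restrict (\<lambda>i. ?X i \<omega>) {..<k} j) = (\<Sum>j<i. ?X j \<omega>)"
            using that by (intro sum.cong) auto
          also have "\<dots> = \<eta> (real i / real n) \<omega>"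
            using sum_lessThan_telescope[of "\<lambda>i. \<eta> (real i / real n) \<omega>" i]
              unkilled_subordinatorD(2)[OF sub \<open>\<omega> \<in> space M\<close>] by simp
          finally show ?thesis .
        qed
        then show ?thesis
          unfolding left_sum_def by (intro sum.cong) auto
      qed
      then show ?thesis
        by (auto simp: below_level_def space_PiM)
    qed
    show "?B (Suc k) \<subseteq> ?B k" for k
      by (rule below_level_Suc_subset) (rule unkilled_subordinatorD(5)[OF sub])
  qed
  have le: "indicator (?B k - ?B (Suc k)) \<omega> *
        ennreal (exp (\<mu> * t - \<mu> * (real (Suc k) / real n * \<eta> (real (Suc k) / real n) \<omega>) +
          (\<Sum>i<Suc k. \<psi> (\<mu> * (real (Suc i) / real n)) / real n)))
      \<le> indicator (?B k - ?B (Suc k)) \<omega> * (\<Prod>i<Suc k. F i (?X i \<omega>))"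
    if \<omega>: "\<omega> \<in> space M" for k \<omega>
  proof (cases "\<omega> \<in> ?B k - ?B (Suc k)")
    case True
    then have exceed: "t \<le> left_sum \<eta> n (Suc k) \<omega>"
      using \<omega> by (auto simp: below_level_def)
    have "(\<Prod>i<Suc k. F i (?X i \<omega>)) = ennreal (exp (\<Sum>i<Suc k. - (\<mu> * (real (Suc i) / real n)) * ?X i \<omega> +
        \<psi> (\<mu> * (real (Suc i) / real n)) / real n))"
      unfolding F_def by (simp only: exp_add[symmetric] prod_ennreal exp_ge_zero exp_sum finite_lessThan)
    also have "(\<Sum>i<Suc k. - (\<mu> * (real (Suc i) / real n)) * ?X i \<omega> +
        \<psi> (\<mu> * (real (Suc i) / real n)) / real n)
      = - \<mu> * (\<Sum>i<Suc k. real (Suc i) / real n * ?X i \<omega>) + (\<Sum>i<Suc k. \<psi> (\<mu> * (real (Suc i) / real n)) / real n)"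
      unfolding sum.distrib sum_distrib_left by (intro arg_cong2[where f = "(+)"] sum.cong) auto
    also have "(\<Sum>i<Suc k. real (Suc i) / real n * ?X i \<omega>)
        = real (Suc k) / real n * \<eta> (real (Suc k) / real n) \<omega> - left_sum \<eta> n (Suc k) \<omega>"
      by (rule mult_left_sum_increments[where \<eta> = \<eta> and \<omega> = \<omega>, OF unkilled_subordinatorD(2)[OF sub \<omega>]])
    finally have prod: "(\<Prod>i<Suc k. F i (?X i \<omega>)) = ennreal (exp (- \<mu> *
        (real (Suc k) / real n * \<eta> (real (Suc k) / real n) \<omega> - left_sum \<eta> n (Suc k) \<omega>) +
        (\<Sum>i<Suc k. \<psi> (\<mu> * (real (Suc i) / real n)) / real n)))" .
    have "\<mu> * t \<le> \<mu> * left_sum \<eta> n (Suc k) \<omega>"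
      using exceed \<mu> by (rule mult_left_mono)
    then have "ennreal (exp (\<mu> * t - \<mu> * (real (Suc k) / real n * \<eta> (real (Suc k) / real n) \<omega>) +
          (\<Sum>i<Suc k. \<psi> (\<mu> * (real (Suc i) / real n)) / real n))) \<le> (\<Prod>i<Suc k. F i (?X i \<omega>))"
      unfolding prod by (intro ennreal_leI) (simp only: exp_le_cancel_iff right_diff_distrib mult_minus_left)
    then show ?thesis
      by (rule mult_left_mono) simp
  next
    case False
    then have "indicator (?B k - ?B (Suc k)) \<omega> = (0 :: ennreal)"
      by (rule indicator_simps(2))
    then show ?thesis
      by (simp only: mult_zero_left order_refl)
  qed
  show ?thesis
    by (rule order_trans[OF suminf_le[OF nn_integral_mono[OF le] summableI summableI] stopped])
qed

end

section \<open>The bound on a grid and its limit\<close>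

text \<open>\<open>\<phi>\<close> belongs to the killed process. Survival up to time 1 has
  probability \<open>exp (- \<kappa>)\<close>, which leaves the exponent
  \<open>\<phi> - \<kappa>\<close> for \<open>\<eta>\<close>.\<close>

locale killed_subordinator = prob_space M for M :: "'a measure" +
  fixes \<eta> :: "real \<Rightarrow> 'a \<Rightarrow> real" and \<zeta> :: "'a \<Rightarrow> ennreal" and \<kappa> :: real and \<phi> :: "real \<Rightarrow> real"
  assumes unkilled: "unkilled_subordinator M \<eta>"
    and killing_time: "exponential_time M \<kappa> \<zeta>"
    and killing_rate: "0 \<le> \<kappa>"
    and indep_killing: "indep_set (sets (vimage_algebra (space M) \<zeta> borel)) (sets (process_sigma M \<eta>))"
    and laplace: "0 \<le> q \<Longrightarrow> (\<integral>\<^sup>+\<omega>. ennreal (exp (- q * \<eta> 1 \<omega>)) \<partial>M) = ennreal (exp (\<kappa> - \<phi> q))"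
begin

lemma mono_exponent: "mono_on {0..} \<phi>"
proof (rule mono_onI)
  fix p q :: real assume pq: "p \<in> {0..}" "q \<in> {0..}" "p \<le> q"
  have "(\<integral>\<^sup>+\<omega>. ennreal (exp (- q * \<eta> 1 \<omega>)) \<partial>M) \<le> (\<integral>\<^sup>+\<omega>. ennreal (exp (- p * \<eta> 1 \<omega>)) \<partial>M)"
    using pq unkilled_subordinatorD(5)[OF unkilled, of _ 1]
    by (intro nn_integral_mono ennreal_leI) (simp add: mult_right_mono)
  then have "ennreal (exp (\<kappa> - \<phi> q)) \<le> ennreal (exp (\<kappa> - \<phi> p))"
    using pq by (simp only: laplace atLeast_iff)
  then show "\<phi> p \<le> \<phi> q"
    by simp
qed

lemma exponent_0: "\<phi> 0 = \<kappa>"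
  using laplace[of 0] emeasure_space_1 by (simp add: ennreal_eq_1)

lemma exponent_nonneg: "0 \<le> q \<Longrightarrow> 0 \<le> \<phi> q"
  using mono_onD[OF mono_exponent, of 0 q] exponent_0 killing_rate by simp

lemma measurable_killing_time: "\<zeta> \<in> borel_measurable M"
  using killing_time by (simp add: exponential_time_def)

abbreviation grid :: "nat \<Rightarrow> nat \<Rightarrow> real" where
  "grid n k \<equiv> real (Suc k) / real n"

abbreviation exceed_at :: "real \<Rightarrow> nat \<Rightarrow> nat \<Rightarrow> 'a set" where
  "exceed_at t n k \<equiv> below_level M \<eta> t n k - below_level M \<eta> t n (Suc k)"

lemma sets_exceed_at: "exceed_at t n k \<in> sets M"
  using unkilled_subordinatorD(1)[OF unkilled] by (intro sets.Diff sets_below_level) auto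

text \<open>In each summand the grid time \<open>s\<close> is deterministic, so independence
  replaces the survival event by the factor \<open>exp (- \<kappa> * s)\<close>, which accounts for
  the \<open>\<kappa>\<close> in \<open>\<phi> - \<kappa>\<close>. The quotient by
  \<open>\<mu>\<close> is the integral of \<open>\<phi> (\<mu> * u)\<close> over \<open>u\<close> in
  \<open>{0..s}\<close>.\<close>

lemma suminf_killed_grid_le_1:
  assumes n: "0 < n" and \<mu>: "0 < \<mu>"
  shows "(\<Sum>k. \<integral>\<^sup>+\<omega>. indicator (exceed_at t n k) \<omega> * (if ennreal (grid n k) < \<zeta> \<omega>
      then ennreal (exp (\<mu> * t - \<mu> * (grid n k * \<eta> (grid n k) \<omega>) +
        integrated_exponent \<phi> (\<mu> * grid n k) / \<mu>)) else 0) \<partial>M) \<le> 1"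
proof -
  have summand: "(\<integral>\<^sup>+\<omega>. indicator (exceed_at t n k) \<omega> * (if ennreal (grid n k) < \<zeta> \<omega>
      then ennreal (exp (\<mu> * t - \<mu> * (grid n k * \<eta> (grid n k) \<omega>) +
        integrated_exponent \<phi> (\<mu> * grid n k) / \<mu>)) else 0) \<partial>M)
    \<le> (\<integral>\<^sup>+\<omega>. indicator (exceed_at t n k) \<omega> *
      ennreal (exp (\<mu> * t - \<mu> * (grid n k * \<eta> (grid n k) \<omega>) +
        (\<Sum>i<Suc k. (\<phi> (\<mu> * grid n i) - \<kappa>) / real n))) \<partial>M)" (is "?l \<le> ?r") for k
  proof -
    define s where "s = grid n k"
    define I where "I = integrated_exponent \<phi> (\<mu> * s) / \<mu>"
    have s: "0 \<le> s"
      by (simp add: s_def)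
    have riemann: "I - \<kappa> * s \<le> (\<Sum>i<Suc k. (\<phi> (\<mu> * grid n i) - \<kappa>) / real n)"
    proof -
      have "integrated_exponent \<phi> (real (Suc k) * (\<mu> / real n))
          \<le> (\<Sum>i<Suc k. \<mu> / real n * \<phi> (real (Suc i) * (\<mu> / real n)))"
        using \<mu> by (intro integrated_exponent_le_riemann_sum mono_exponent) simp
      also have "\<dots> = \<mu> * (\<Sum>i<Suc k. \<phi> (\<mu> * grid n i) / real n)"
        unfolding sum_distrib_left by (intro sum.cong) (simp_all add: mult_ac)
      finally have "I \<le> (\<Sum>i<Suc k. \<phi> (\<mu> * grid n i) / real n)"
        using \<mu> by (simp add: I_def s_def field_simps)
      moreover have "(\<Sum>i<Suc k. (\<phi> (\<mu> * grid n i) - \<kappa>) / real n)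
          = (\<Sum>i<Suc k. \<phi> (\<mu> * grid n i) / real n) - \<kappa> * s"
        unfolding diff_divide_distrib sum_subtractf by (simp add: s_def)
      ultimately show ?thesis
        by simp
    qed
    let ?Z = "{\<omega> \<in> space M. ennreal s < \<zeta> \<omega>}"
    let ?f = "\<lambda>\<omega>. indicator (exceed_at t n k) \<omega> * ennreal (exp (\<mu> * t - \<mu> * (s * \<eta> s \<omega>) + I))"
    have "?l = (\<integral>\<^sup>+\<omega>. indicator ?Z \<omega> * ?f \<omega> \<partial>M)"
      unfolding s_def[symmetric] I_def[symmetric]
      by (intro nn_integral_cong) (simp add: indicator_def)
    also have "\<dots> = emeasure M ?Z * (\<integral>\<^sup>+\<omega>. ?f \<omega> \<partial>M)"
    proof (rule indep_set_nn_integral_indicator_mult[OF indep_killing])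
      have "\<zeta> -` {ennreal s<..} \<inter> space M \<in> sets (vimage_algebra (space M) \<zeta> borel)"
        by (rule in_vimage_algebra) simp
      also have "\<zeta> -` {ennreal s<..} \<inter> space M = ?Z"
        by auto
      finally show "?Z \<in> sets (vimage_algebra (space M) \<zeta> borel)" .
      note measurable_process_sigma[OF s, of \<eta> M, measurable]
      have [measurable]: "exceed_at t n k \<in> sets (process_sigma M \<eta>)"
        by (intro sets.Diff sets_below_level measurable_process_sigma) auto
      show "?f \<in> borel_measurable (process_sigma M \<eta>)"
        by measurable
    qed simp_all
    also have "\<dots> = (\<integral>\<^sup>+\<omega>. ennreal (exp (- \<kappa> * s)) * ?f \<omega> \<partial>M)"
    proof -
      note unkilled_subordinatorD(1)[OF unkilled s, measurable] sets_exceed_at[measurable]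
      have "?f \<in> borel_measurable M"
        by measurable
      then show ?thesis
        using emeasure_exponential_time_gt[OF killing_time killing_rate s] by (simp add: nn_integral_cmult)
    qed
    also have "\<dots> \<le> ?r"
    proof (intro nn_integral_mono)
      fix \<omega>
      have "ennreal (exp (- \<kappa> * s)) * ennreal (exp (\<mu> * t - \<mu> * (s * \<eta> s \<omega>) + I))
          = ennreal (exp (- \<kappa> * s + (\<mu> * t - \<mu> * (s * \<eta> s \<omega>) + I)))"
        by (simp only: exp_add[of "- \<kappa> * s"] ennreal_mult[symmetric] exp_ge_zero)
      also have "\<dots> \<le> ennreal (exp (\<mu> * t - \<mu> * (s * \<eta> s \<omega>) +
          (\<Sum>i<Suc k. (\<phi> (\<mu> * grid n i) - \<kappa>) / real n)))"
        using riemann by (intro ennreal_leI) simp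
      finally have "indicator (exceed_at t n k) \<omega> * (ennreal (exp (- \<kappa> * s)) *
            ennreal (exp (\<mu> * t - \<mu> * (s * \<eta> s \<omega>) + I)))
          \<le> indicator (exceed_at t n k) \<omega> * ennreal (exp (\<mu> * t - \<mu> * (s * \<eta> s \<omega>) +
          (\<Sum>i<Suc k. (\<phi> (\<mu> * grid n i) - \<kappa>) / real n)))"
        by (rule mult_left_mono) simp
      then show "ennreal (exp (- \<kappa> * s)) * ?f \<omega>
          \<le> indicator (exceed_at t n k) \<omega> * ennreal (exp (\<mu> * t - \<mu> * (grid n k * \<eta> (grid n k) \<omega>) +
          (\<Sum>i<Suc k. (\<phi> (\<mu> * grid n i) - \<kappa>) / real n)))"
        by (simp only: s_def[symmetric] mult.left_commute)
    qed
    finally show ?thesis .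
  qed
  show ?thesis
    by (rule order_trans[OF suminf_le[OF summand summableI summableI]],
        rule suminf_stopped_grid_le_1[OF unkilled n])
      (use \<mu> laplace in auto)
qed

text \<open>The martingale bound is averaged over \<open>\<mu> = 1 / y\<^sup>2\<close> with the
  weight \<open>w y\<close>. The first term of the bound comes from stopping before time 1, the
  second from stopping later.\<close>

lemma nn_integral_exp_killed_grid_le:
  assumes n: "0 < n" and q: "0 < q" and \<Phi>: "0 < integrated_exponent \<phi> q" and t: "0 \<le> t"
  shows "(\<integral>\<^sup>+\<omega>. (\<Sum>k. indicator (exceed_at t n k) \<omega> * (if ennreal (grid n k) < \<zeta> \<omega>
      then ennreal (exp (- q * \<eta> (grid n k) \<omega>)) else 0)) \<partial>M)
    \<le> ennreal (exp (- q * t)) + ennreal (2 * sqrt q * exp (9 * \<phi> q / 4)) *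
      ennreal (sqrt (pi / integrated_exponent \<phi> q) * exp (- 2 * sqrt (integrated_exponent \<phi> q * t)))"
proof -
  note [measurable] = measurable_killing_time unkilled_subordinatorD(1)[OF unkilled] sets_exceed_at
    borel_measurable_integrated_exponent[OF mono_exponent exponent_nonneg[OF order_refl]]
  define C where "C = ennreal (2 * sqrt q * exp (9 * \<phi> q / 4))"
  define w where "w y = ennreal (exp (- (integrated_exponent \<phi> q * y\<^sup>2) - t / y\<^sup>2)) * indicator {0<..} y" for y
  \<comment> \<open>The stopped martingale for \<open>\<mu> = 1 / y\<^sup>2\<close>. Its value at
    \<open>y = 0\<close>, where division yields 0, does not count because \<open>w\<close> vanishes
    there.\<close>
  define h where "h k y \<omega> = indicator (exceed_at t n k) \<omega> * (if ennreal (grid n k) < \<zeta> \<omega>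
      then ennreal (exp (1 / y\<^sup>2 * t - 1 / y\<^sup>2 * (grid n k * \<eta> (grid n k) \<omega>) +
        integrated_exponent \<phi> (1 / y\<^sup>2 * grid n k) / (1 / y\<^sup>2))) else 0)" for k y \<omega>
  have [measurable]: "w \<in> borel_measurable borel"
    unfolding w_def by measurable
  have eta [measurable]: "\<eta> (grid n k) \<in> borel_measurable M" for k
    by (rule unkilled_subordinatorD(1)[OF unkilled]) simp
  have h [measurable]: "(\<lambda>(\<omega>, y). h k y \<omega>) \<in> borel_measurable (M \<Otimes>\<^sub>M borel)" for k
    unfolding h_def by measurable
  have "(\<lambda>(y, \<omega>). h k y \<omega>) \<in> borel_measurable (borel \<Otimes>\<^sub>M M)" for k
    unfolding h_def by measurable
  then have [measurable]: "(\<lambda>y. \<integral>\<^sup>+\<omega>. h k y \<omega> \<partial>M) \<in> borel_measurable borel" for k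
    by (rule borel_measurable_nn_integral)
  have h' [measurable]: "(\<lambda>(\<omega>, y). w y * h k y \<omega>) \<in> borel_measurable (M \<Otimes>\<^sub>M lborel)" for k
    by measurable
  have pointwise: "indicator (exceed_at t n k) \<omega> * (if ennreal (grid n k) < \<zeta> \<omega>
      then ennreal (exp (- q * \<eta> (grid n k) \<omega>)) else 0)
    \<le> indicator (exceed_at t n k) \<omega> * ennreal (exp (- q * t)) + C * (\<integral>\<^sup>+y. w y * h k y \<omega> \<partial>lborel)"
    if \<omega>: "\<omega> \<in> space M" for k \<omega>
  proof (cases "\<omega> \<in> exceed_at t n k \<and> ennreal (grid n k) < \<zeta> \<omega>")
    case False
    then show ?thesis
      by (cases "\<omega> \<in> exceed_at t n k") (simp_all del: Diff_iff)
  next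
    case True
    define R x where "R = grid n k" and "x = \<eta> R \<omega>"
    have x: "0 \<le> x"
      unfolding x_def R_def using \<omega> by (intro unkilled_subordinatorD(5)[OF unkilled]) auto
    have goal: ?thesis if "ennreal (exp (- q * x)) \<le> ennreal (exp (- q * t)) + C * (\<integral>\<^sup>+y. w y * h k y \<omega> \<partial>lborel)"
      using that True by (simp add: R_def x_def del: Diff_iff)
    show ?thesis
    proof (cases "R < 1")
      case True': True
      \<comment> \<open>A monotone path has left sum at most \<open>R * x\<close>, so stopping
        before time 1 forces \<open>t < x\<close>.\<close>
      have "t < left_sum \<eta> n (Suc k) \<omega>"
        using True \<omega> by (auto simp: below_level_def)
      also have "\<dots> \<le> (\<Sum>i<Suc k. x / real n)"
        unfolding left_sum_def x_def R_def
        by (intro sum_mono divide_right_mono mono_onD[OF unkilled_subordinatorD(3)[OF unkilled \<omega>]])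
          (auto intro: divide_right_mono)
      also have "\<dots> = R * x"
        by (simp add: R_def)
      also have "\<dots> \<le> 1 * x"
        using True' x by (intro mult_right_mono) auto
      finally have "ennreal (exp (- q * x)) \<le> ennreal (exp (- q * t))"
        using q by (intro ennreal_leI) simp
      then show ?thesis
        by (intro goal add_increasing2) auto
    next
      case False
      have "ennreal (exp (- q * x)) \<le> C * (\<integral>\<^sup>+y. ennreal (exp (- (R * x / y\<^sup>2) + \<phi> q * (R - q * y\<^sup>2))) *
          indicator {0<..} y \<partial>lborel)"
        unfolding C_def using False q x exponent_nonneg[of q] by (intro exp_le_nn_integral_window) auto
      also have "\<dots> \<le> C * (\<integral>\<^sup>+y. w y * h k y \<omega> \<partial>lborel)"
      proof (intro mult_left_mono nn_integral_mono)
        fix y :: real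
        show "ennreal (exp (- (R * x / y\<^sup>2) + \<phi> q * (R - q * y\<^sup>2))) * indicator {0<..} y \<le> w y * h k y \<omega>"
        proof (cases "0 < y")
          case y: True
          \<comment> \<open>The tangent at \<open>q\<close> is evaluated at
            \<open>R / y\<^sup>2\<close> and multiplied by \<open>y\<^sup>2\<close>. The terms
            \<open>t / y\<^sup>2\<close> of weight and martingale cancel, which leaves the integrand
            of \<open>exp_le_nn_integral_window\<close> with \<open>p = \<phi> q\<close>.\<close>
          have "\<phi> q * (R / y\<^sup>2 - q) \<le> integrated_exponent \<phi> (R / y\<^sup>2) - integrated_exponent \<phi> q"
            using q False by (intro integrated_exponent_tangent[OF mono_exponent]) auto
          then have "y\<^sup>2 * (\<phi> q * (R / y\<^sup>2 - q)) \<le> y\<^sup>2 * (integrated_exponent \<phi> (R / y\<^sup>2) - integrated_exponent \<phi> q)"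
            by (rule mult_left_mono) simp
          moreover have "y\<^sup>2 * (\<phi> q * (R / y\<^sup>2 - q)) = \<phi> q * (R - q * y\<^sup>2)"
            using y by (simp add: field_simps)
          ultimately have "exp (- (R * x / y\<^sup>2) + \<phi> q * (R - q * y\<^sup>2))
              \<le> exp ((- (integrated_exponent \<phi> q * y\<^sup>2) - t / y\<^sup>2) +
                (1 / y\<^sup>2 * t - 1 / y\<^sup>2 * (R * x) + integrated_exponent \<phi> (1 / y\<^sup>2 * R) / (1 / y\<^sup>2)))"
            by (simp add: algebra_simps)
          then have "ennreal (exp (- (R * x / y\<^sup>2) + \<phi> q * (R - q * y\<^sup>2)))
              \<le> ennreal (exp (- (integrated_exponent \<phi> q * y\<^sup>2) - t / y\<^sup>2)) *
                ennreal (exp (1 / y\<^sup>2 * t - 1 / y\<^sup>2 * (R * x) + integrated_exponent \<phi> (1 / y\<^sup>2 * R) / (1 / y\<^sup>2)))"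
            by (simp only: exp_add[of "- (integrated_exponent \<phi> q * y\<^sup>2) - t / y\<^sup>2"] ennreal_mult[symmetric] exp_ge_zero ennreal_leI)
          moreover have "h k y \<omega> = ennreal (exp (1 / y\<^sup>2 * t - 1 / y\<^sup>2 * (R * x) +
              integrated_exponent \<phi> (1 / y\<^sup>2 * R) / (1 / y\<^sup>2)))"
            using True by (simp add: h_def R_def x_def del: Diff_iff)
          ultimately show ?thesis
            using y by (simp add: w_def)
        qed simp
      qed simp
      finally show ?thesis
        by (intro goal add_increasing) auto
    qed
  qed
  \<comment> \<open>A path stops at no more than one index, so the events are disjoint and
    \<open>exp (- q * t)\<close> is counted at most once.\<close>
  have level: "(\<Sum>k. \<integral>\<^sup>+\<omega>. indicator (exceed_at t n k) \<omega> \<partial>M) \<le> (1 :: ennreal)"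
  proof -
    have anti: "below_level M \<eta> t n (Suc k) \<subseteq> below_level M \<eta> t n k" for k
      by (rule below_level_Suc_subset) (rule unkilled_subordinatorD(5)[OF unkilled])
    have "disjoint_family (exceed_at t n)"
    proof -
      have "below_level M \<eta> t n m \<subseteq> below_level M \<eta> t n (Suc k)" if "k < m" for k m
        using lift_Suc_antimono_le[of "below_level M \<eta> t n", OF anti, of "Suc k" m] that by simp
      then have "exceed_at t n k \<inter> exceed_at t n m = {}" if "k < m" for k m
        using that by blast
      then show ?thesis
        unfolding disjoint_family_on_def by (metis inf_commute linorder_neqE_nat)
    qed
    then have "(\<Sum>k. emeasure M (exceed_at t n k)) = emeasure M (\<Union>k. exceed_at t n k)"
      using sets_exceed_at by (intro suminf_emeasure) auto
    also have "\<dots> \<le> 1"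
      by (rule emeasure_le_1)
    finally show ?thesis
      using sets_exceed_at by simp
  qed
  have w_le: "w y * (\<Sum>k. \<integral>\<^sup>+\<omega>. h k y \<omega> \<partial>M) \<le> w y * 1" for y
  proof (cases "0 < y")
    case True
    then have "(\<Sum>k. \<integral>\<^sup>+\<omega>. h k y \<omega> \<partial>M) \<le> 1"
      unfolding h_def using n by (intro suminf_killed_grid_le_1) auto
    then show ?thesis
      by (rule mult_left_mono) simp
  qed (simp add: w_def)
  have "(\<integral>\<^sup>+\<omega>. (\<Sum>k. indicator (exceed_at t n k) \<omega> * (if ennreal (grid n k) < \<zeta> \<omega>
      then ennreal (exp (- q * \<eta> (grid n k) \<omega>)) else 0)) \<partial>M)
    = (\<Sum>k. \<integral>\<^sup>+\<omega>. indicator (exceed_at t n k) \<omega> * (if ennreal (grid n k) < \<zeta> \<omega>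
      then ennreal (exp (- q * \<eta> (grid n k) \<omega>)) else 0) \<partial>M)"
    by (rule nn_integral_suminf) measurable
  also have "\<dots> \<le> (\<Sum>k. \<integral>\<^sup>+\<omega>. (indicator (exceed_at t n k) \<omega> * ennreal (exp (- q * t)) +
      C * (\<integral>\<^sup>+y. w y * h k y \<omega> \<partial>lborel)) \<partial>M)"
    by (intro suminf_le summableI nn_integral_mono pointwise)
  also have "\<dots> = (\<Sum>k. (\<integral>\<^sup>+\<omega>. indicator (exceed_at t n k) \<omega> \<partial>M) * ennreal (exp (- q * t)) +
      C * (\<integral>\<^sup>+y. w y * (\<integral>\<^sup>+\<omega>. h k y \<omega> \<partial>M) \<partial>lborel))"
  proof (intro suminf_cong)
    fix k
    interpret pair_sigma_finite M lborel ..
    have "(\<integral>\<^sup>+\<omega>. (\<integral>\<^sup>+y. w y * h k y \<omega> \<partial>lborel) \<partial>M) = (\<integral>\<^sup>+y. (\<integral>\<^sup>+\<omega>. w y * h k y \<omega> \<partial>M) \<partial>lborel)"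
      using Fubini'[OF h'] by simp
    also have "\<dots> = (\<integral>\<^sup>+y. w y * (\<integral>\<^sup>+\<omega>. h k y \<omega> \<partial>M) \<partial>lborel)"
      by (intro nn_integral_cong nn_integral_cmult) measurable
    finally show "(\<integral>\<^sup>+\<omega>. (indicator (exceed_at t n k) \<omega> * ennreal (exp (- q * t)) +
        C * (\<integral>\<^sup>+y. w y * h k y \<omega> \<partial>lborel)) \<partial>M)
      = (\<integral>\<^sup>+\<omega>. indicator (exceed_at t n k) \<omega> \<partial>M) * ennreal (exp (- q * t)) +
        C * (\<integral>\<^sup>+y. w y * (\<integral>\<^sup>+\<omega>. h k y \<omega> \<partial>M) \<partial>lborel)"
      by (subst nn_integral_add; (subst nn_integral_cmult)?; (subst nn_integral_multc)?) measurable
  qed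
  also have "\<dots> = (\<Sum>k. \<integral>\<^sup>+\<omega>. indicator (exceed_at t n k) \<omega> \<partial>M) * ennreal (exp (- q * t)) +
      C * (\<Sum>k. \<integral>\<^sup>+y. w y * (\<integral>\<^sup>+\<omega>. h k y \<omega> \<partial>M) \<partial>lborel)"
    by (simp only: suminf_add[OF summableI summableI, symmetric] ennreal_suminf_multc ennreal_suminf_cmult)
  also have "(\<Sum>k. \<integral>\<^sup>+y. w y * (\<integral>\<^sup>+\<omega>. h k y \<omega> \<partial>M) \<partial>lborel)
      = (\<integral>\<^sup>+y. w y * (\<Sum>k. \<integral>\<^sup>+\<omega>. h k y \<omega> \<partial>M) \<partial>lborel)"
    unfolding ennreal_suminf_cmult[symmetric] by (rule nn_integral_suminf[symmetric]) measurable
  also have "(\<Sum>k. \<integral>\<^sup>+\<omega>. indicator (exceed_at t n k) \<omega> \<partial>M) * ennreal (exp (- q * t)) +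
      C * (\<integral>\<^sup>+y. w y * (\<Sum>k. \<integral>\<^sup>+\<omega>. h k y \<omega> \<partial>M) \<partial>lborel)
    \<le> 1 * ennreal (exp (- q * t)) + C * (\<integral>\<^sup>+y. w y * 1 \<partial>lborel)"
    by (intro add_mono mult_right_mono[OF level] mult_left_mono[OF nn_integral_mono[OF w_le]]) simp_all
  also have "\<dots> \<le> ennreal (exp (- q * t)) + C *
      ennreal (sqrt (pi / integrated_exponent \<phi> q) * exp (- 2 * sqrt (integrated_exponent \<phi> q * t)))"
    unfolding w_def mult_1 mult_1_right
    by (intro add_left_mono mult_left_mono nn_integral_exp_square_inverse_square_le \<Phi> t) simp
  finally show ?thesis
    by (simp only: C_def)
qed

lemma integral_exp_neg_time_change_le:
  assumes \<xi>: "\<And>u \<omega>. 0 \<le> u \<Longrightarrow> \<omega> \<in> space M \<Longrightarrow>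
      \<xi> u \<omega> = (if ennreal u < \<zeta> \<omega> then ennreal (\<eta> u \<omega>) else \<infinity>)"
    and nontrivial: "\<kappa> < \<phi> 1"
    and q: "0 < q" and \<Phi>: "0 < integrated_exponent \<phi> q" and t: "0 \<le> t"
  shows "(\<integral>\<omega>. exp_neg q (value_at \<xi> (time_change \<xi> t) \<omega>) \<partial>M)
    \<le> (exp (integrated_exponent \<phi> q / q) + 2 * sqrt q * exp (9 * \<phi> q / 4) * sqrt (pi / integrated_exponent \<phi> q)) *
      exp (- 2 * sqrt (integrated_exponent \<phi> q * t))" (is "?I \<le> ?a * ?e")
proof (cases "integrable M (\<lambda>\<omega>. exp_neg q (value_at \<xi> (time_change \<xi> t) \<omega>))")
  \<comment> \<open>The Bochner integral is then 0 by convention, so measurability of the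
    time-changed process need not be shown.\<close>
  case False
  then show ?thesis
    using q \<Phi> by (simp add: not_integrable_integral_eq)
next
  case True
  note [measurable] = measurable_killing_time sets_exceed_at
  have [measurable]: "\<eta> (grid n k) \<in> borel_measurable M" for n k
    by (rule unkilled_subordinatorD(1)[OF unkilled]) simp
  let ?g = "\<lambda>n \<omega>. \<Sum>k. indicator (exceed_at t (Suc n) k) \<omega> * (if ennreal (grid (Suc n) k) < \<zeta> \<omega>
      then ennreal (exp (- q * \<eta> (grid (Suc n) k) \<omega>)) else 0)"
  have AE: "AE \<omega> in M. ennreal (exp_neg q (value_at \<xi> (time_change \<xi> t) \<omega>)) \<le> liminf (\<lambda>n. ?g n \<omega>)"
  proof -
    have "AE \<omega> in M. \<exists>s\<ge>0. 0 < \<eta> s \<omega>"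
      using laplace[of 1] nontrivial by (intro AE_subordinator_nonzero[OF unkilled, of "\<phi> 1 - \<kappa>"]) auto
    then show ?thesis
    proof (rule AE_mp, intro AE_I2 impI)
      fix \<omega> assume \<omega>: "\<omega> \<in> space M" and "\<exists>s\<ge>0. 0 < \<eta> s \<omega>"
      then obtain s where "0 \<le> s" "0 < \<eta> s \<omega>"
        by blast
      then show "ennreal (exp_neg q (value_at \<xi> (time_change \<xi> t) \<omega>)) \<le> liminf (\<lambda>n. ?g n \<omega>)"
        using \<omega> q t by (intro exp_neg_time_change_le_liminf[where s = s] \<xi> unkilled_subordinatorD[OF unkilled]) auto
    qed
  qed
  \<comment> \<open>Arithmetic-geometric mean for \<open>q * t\<close> and
    \<open>integrated_exponent \<phi> q / q\<close>, bringing both terms of the grid bound to the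
    common factor \<open>?e\<close>.\<close>
  have young: "exp (- q * t) \<le> exp (integrated_exponent \<phi> q / q) * ?e"
  proof -
    have "0 \<le> (sqrt (q * t) - sqrt (integrated_exponent \<phi> q / q))\<^sup>2"
      by simp
    also have "\<dots> = q * t + integrated_exponent \<phi> q / q - 2 * (sqrt (q * t) * sqrt (integrated_exponent \<phi> q / q))"
      using q \<Phi> t by (simp add: power2_diff)
    also have "sqrt (q * t) * sqrt (integrated_exponent \<phi> q / q) = sqrt (integrated_exponent \<phi> q * t)"
      using q by (simp add: real_sqrt_mult[symmetric] mult.commute)
    finally have "exp (- q * t) \<le> exp (integrated_exponent \<phi> q / q + - 2 * sqrt (integrated_exponent \<phi> q * t))"
      by simp
    then show ?thesis
      by (simp only: exp_add)
  qed
  let ?C = "2 * sqrt q * exp (9 * \<phi> q / 4)" and ?D = "sqrt (pi / integrated_exponent \<phi> q)"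
  have "ennreal ?I = (\<integral>\<^sup>+\<omega>. ennreal (exp_neg q (value_at \<xi> (time_change \<xi> t) \<omega>)) \<partial>M)"
    using True by (intro nn_integral_eq_integral[symmetric]) (auto simp: exp_neg_def)
  also have "\<dots> \<le> (\<integral>\<^sup>+\<omega>. liminf (\<lambda>n. ?g n \<omega>) \<partial>M)"
    by (rule nn_integral_mono_AE[OF AE])
  also have "\<dots> \<le> liminf (\<lambda>n. \<integral>\<^sup>+\<omega>. ?g n \<omega> \<partial>M)"
    by (rule nn_integral_liminf) measurable
  also have "\<dots> \<le> liminf (\<lambda>n :: nat. ennreal (exp (- q * t)) + ennreal ?C * ennreal (?D * ?e))"
    by (intro Liminf_mono always_eventually allI nn_integral_exp_killed_grid_le[OF _ q \<Phi> t]) simp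
  also have "\<dots> = ennreal (exp (- q * t)) + ennreal ?C * ennreal (?D * ?e)"
    by (rule Liminf_const) simp
  also have "\<dots> = ennreal (exp (- q * t) + ?C * (?D * ?e))"
    using q \<Phi> by (simp add: ennreal_mult[symmetric])
  also have "\<dots> \<le> ennreal (?a * ?e)"
    using young by (intro ennreal_leI) (simp add: algebra_simps)
  finally show ?thesis
    using q \<Phi> by (subst (asm) ennreal_le_iff) (auto intro!: mult_nonneg_nonneg add_nonneg_nonneg)
qed

end

section \<open>The Levy integral, the exponent of the unkilled process, and the conclusion\<close>

lemma levy_integral_pos:
  assumes \<pi>: "subordinator_levy_measure \<pi>" and pos: "0 < emeasure \<pi> {0<..}" and q: "0 < q"
  shows "0 < (\<integral>x. (1 - exp (- q * x)) \<partial>\<pi>)"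
proof -
  have sets [measurable_cong]: "sets \<pi> = sets (restrict_space borel {0<..})"
    and fin: "(\<integral>\<^sup>+x. ennreal (min 1 x) \<partial>\<pi>) < \<infinity>"
    using \<pi> by (auto simp: subordinator_levy_measure_def)
  have space: "space \<pi> = {0<..}"
    using sets_eq_imp_space_eq[OF sets] by (simp add: space_restrict_space)
  have meas: "f \<in> borel_measurable \<pi>" if "f \<in> borel_measurable borel" for f :: "real \<Rightarrow> real"
    using measurable_restrict_space1[OF that, of "{0<..}"] measurable_cong_sets[OF sets refl] by blast
  have "integrable \<pi> (\<lambda>x. min 1 x)"
    using fin by (intro integrableI_nonneg meas) (auto simp: space)
  then have "integrable \<pi> (\<lambda>x. max 1 q * min 1 x)"
    by simp
  \<comment> \<open>Without integrability the integral would be 0 by convention. The bound is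
    \<open>1 - exp (- q * x) \<le> min 1 (q * x)\<close>, weakened to a multiple of
    \<open>min 1 x\<close>.\<close>
  then have int: "integrable \<pi> (\<lambda>x. 1 - exp (- q * x))"
  proof (rule Bochner_Integration.integrable_bound)
    have "norm (1 - exp (- q * x)) \<le> norm (max 1 q * min 1 x)" if "x \<in> space \<pi>" for x
    proof -
      have x: "0 < x"
        using that space by simp
      have "1 - exp (- q * x) \<le> max 1 q * min 1 x"
      proof (cases "x \<le> 1")
        case True
        have "1 - exp (- q * x) \<le> q * x"
          using exp_ge_add_one_self[of "- q * x"] by simp
        also have "\<dots> \<le> max 1 q * x"
          using x by (intro mult_right_mono) auto
        finally show ?thesis
          using True by simp
      next
        case False
        have "1 - exp (- q * x) \<le> 1"
          by simp
        also have "\<dots> \<le> max 1 q * min 1 x"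
          using False by simp
        finally show ?thesis .
      qed
      moreover have "0 \<le> 1 - exp (- q * x)"
        using q x by simp
      ultimately show ?thesis
        by simp
    qed
    then show "AE x in \<pi>. norm (1 - exp (- q * x)) \<le> norm (max 1 q * min 1 x)"
      by (intro AE_I2)
  qed (intro meas, measurable)
  have nonneg: "AE x in \<pi>. 0 \<le> 1 - exp (- q * x)"
    using q by (intro AE_I2) (simp add: space)
  have "(\<integral>x. (1 - exp (- q * x)) \<partial>\<pi>) \<noteq> 0"
  proof
    assume "(\<integral>x. (1 - exp (- q * x)) \<partial>\<pi>) = 0"
    then have "AE x in \<pi>. 1 - exp (- q * x) = 0"
      using integral_nonneg_eq_0_iff_AE[OF int nonneg] by simp
    then have "AE x in \<pi>. False"
      by (rule AE_mp) (use q in \<open>auto intro!: AE_I2 simp: space\<close>)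
    moreover have "(AE x in \<pi>. False) \<longleftrightarrow> emeasure \<pi> (space \<pi>) = 0"
      by (rule AE_iff_measurable) auto
    ultimately have "emeasure \<pi> {0<..} = 0"
      by (simp only: space)
    then show False
      using pos by simp
  qed
  then show ?thesis
    using integral_nonneg_AE[OF nonneg] by simp
qed

text \<open>By independence the killed transform at time 1 is \<open>exp (- \<kappa>)\<close> times
  that of \<open>\<eta>\<close>; the logarithm turns this factor into the shift by
  \<open>\<kappa>\<close>.\<close>

lemma (in prob_space) nn_integral_exp_eq_laplace_exponent:
  assumes \<eta>: "unkilled_subordinator M \<eta>" and \<zeta>: "exponential_time M \<kappa> \<zeta>" and \<kappa>: "0 \<le> \<kappa>"
    and indep: "indep_set (sets (vimage_algebra (space M) \<zeta> borel)) (sets (process_sigma M \<eta>))"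
    and \<xi>: "\<And>\<omega>. \<omega> \<in> space M \<Longrightarrow> \<xi> 1 \<omega> = (if ennreal 1 < \<zeta> \<omega> then ennreal (\<eta> 1 \<omega>) else \<infinity>)"
    and q: "0 \<le> q"
  shows "(\<integral>\<^sup>+\<omega>. ennreal (exp (- q * \<eta> 1 \<omega>)) \<partial>M) = ennreal (exp (\<kappa> - laplace_exponent M \<xi> q))"
proof -
  have [measurable]: "\<zeta> \<in> borel_measurable M" "\<eta> 1 \<in> borel_measurable M"
    using \<zeta> unkilled_subordinatorD(1)[OF \<eta>] by (auto simp: exponential_time_def)
  let ?m = "\<integral>\<^sup>+\<omega>. ennreal (exp (- q * \<eta> 1 \<omega>)) \<partial>M"
  let ?Z = "{\<omega> \<in> space M. ennreal 1 < \<zeta> \<omega>}"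
  have nonneg: "0 \<le> \<eta> 1 \<omega>" if "\<omega> \<in> space M" for \<omega>
    using that by (intro unkilled_subordinatorD(5)[OF \<eta>]) auto
  have "?m \<le> (\<integral>\<^sup>+\<omega>. 1 \<partial>M)"
    using q nonneg by (intro nn_integral_mono) (simp add: ennreal_le_1)
  then have "?m \<le> 1"
    by (simp add: emeasure_space_1)
  then obtain r where r: "0 \<le> r" "?m = ennreal r"
    using order_le_less_trans[OF _ ennreal_one_less_top] by (cases ?m) auto
  \<comment> \<open>Positivity is required to invert the logarithm in
    \<open>laplace_exponent\<close>.\<close>
  have "r \<noteq> 0"
  proof
    assume "r = 0"
    then have "?m = 0"
      using r by simp
    then have "AE \<omega> in M. ennreal (exp (- q * \<eta> 1 \<omega>)) = 0"
      by (subst (asm) nn_integral_0_iff_AE) auto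
    then show False
      by simp
  qed
  with r have "0 < r"
    by simp
  have eq: "exp_neg q (\<xi> 1 \<omega>) = indicator ?Z \<omega> * exp (- q * \<eta> 1 \<omega>)" if "\<omega> \<in> space M" for \<omega>
    using that nonneg[OF that] by (simp add: \<xi> exp_neg_def)
  have "(\<integral>\<omega>. exp_neg q (\<xi> 1 \<omega>) \<partial>M) = (\<integral>\<omega>. indicator ?Z \<omega> * exp (- q * \<eta> 1 \<omega>) \<partial>M)"
    by (intro Bochner_Integration.integral_cong refl eq)
  also have "\<dots> = enn2real (\<integral>\<^sup>+\<omega>. ennreal (indicator ?Z \<omega> * exp (- q * \<eta> 1 \<omega>)) \<partial>M)"
    by (intro integral_eq_nn_integral) auto
  also have "(\<integral>\<^sup>+\<omega>. ennreal (indicator ?Z \<omega> * exp (- q * \<eta> 1 \<omega>)) \<partial>M)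
      = (\<integral>\<^sup>+\<omega>. indicator ?Z \<omega> * ennreal (exp (- q * \<eta> 1 \<omega>)) \<partial>M)"
    by (intro nn_integral_cong) (simp add: indicator_def)
  also have "\<dots> = emeasure M ?Z * ?m"
  proof (rule indep_set_nn_integral_indicator_mult[OF indep])
    have "\<zeta> -` {ennreal 1<..} \<inter> space M \<in> sets (vimage_algebra (space M) \<zeta> borel)"
      by (rule in_vimage_algebra) simp
    also have "\<zeta> -` {ennreal 1<..} \<inter> space M = ?Z"
      by auto
    finally show "?Z \<in> sets (vimage_algebra (space M) \<zeta> borel)" .
    note measurable_process_sigma[of 1 \<eta> M, measurable]
    show "(\<lambda>\<omega>. ennreal (exp (- q * \<eta> 1 \<omega>))) \<in> borel_measurable (process_sigma M \<eta>)"
      by measurable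
  qed simp_all
  also have "\<dots> = ennreal (exp (- \<kappa>) * r)"
    using emeasure_exponential_time_gt[OF \<zeta> \<kappa>, of 1] r by (simp add: ennreal_mult)
  finally have "(\<integral>\<omega>. exp_neg q (\<xi> 1 \<omega>) \<partial>M) = exp (- \<kappa>) * r"
    using r by simp
  then have "laplace_exponent M \<xi> q = \<kappa> - ln r"
    using \<open>0 < r\<close> by (simp add: laplace_exponent_def ln_mult)
  then show ?thesis
    using r \<open>0 < r\<close> by simp
qed

theorem proposition1p3:
  fixes M :: "'a measure" and \<xi> :: "real \<Rightarrow> 'a \<Rightarrow> ennreal"
    and \<phi> :: "real \<Rightarrow> real" and \<kappa> c :: real and \<pi> :: "real measure"
  assumes "prob_space M"
    and "subordinator M \<kappa> \<xi>"
    and "0 \<le> c"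
    and "subordinator_levy_measure \<pi>"
    and "0 < emeasure \<pi> {0<..}"
    and "\<And>q. 0 \<le> q \<Longrightarrow> \<phi> q = laplace_exponent M \<xi> q"
    and "\<And>q. 0 \<le> q \<Longrightarrow> \<phi> q = \<kappa> + c * q + (\<integral>x. (1 - exp (- q * x)) \<partial>\<pi>)"
  shows "\<forall>q>0. \<exists>a>0. \<forall>t\<ge>0.
    (\<integral>\<omega>. exp_neg q (value_at \<xi> (time_change \<xi> t) \<omega>) \<partial>M)
      \<le> a * (1 + t powr (1 / 8)) * exp (- 2 * sqrt (integrated_exponent \<phi> q * t))"
proof (intro allI impI)
  fix q :: real assume q: "0 < q"
  interpret prob_space M by fact
  obtain \<eta> \<zeta> where \<kappa>: "0 \<le> \<kappa>" and \<eta>: "unkilled_subordinator M \<eta>" and \<zeta>: "exponential_time M \<kappa> \<zeta>"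
    and indep: "indep_set (sets (vimage_algebra (space M) \<zeta> borel)) (sets (process_sigma M \<eta>))"
    and \<xi>: "\<And>t \<omega>. 0 \<le> t \<Longrightarrow> \<omega> \<in> space M \<Longrightarrow>
      \<xi> t \<omega> = (if ennreal t < \<zeta> \<omega> then ennreal (\<eta> t \<omega>) else \<infinity>)"
    using assms(2) unfolding subordinator_def process_sigma_def by blast
  interpret killed_subordinator M \<eta> \<zeta> \<kappa> \<phi>
  proof
    show "(\<integral>\<^sup>+\<omega>. ennreal (exp (- p * \<eta> 1 \<omega>)) \<partial>M) = ennreal (exp (\<kappa> - \<phi> p))" if "0 \<le> p" for p
      unfolding assms(6)[OF that]
      by (rule nn_integral_exp_eq_laplace_exponent[OF \<eta> \<zeta> \<kappa> indep _ that]) (rule \<xi>, simp_all)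
  qed (fact \<eta> \<zeta> \<kappa> indep)+
  have gt: "\<kappa> < \<phi> p" if "0 < p" for p
  proof -
    have "0 \<le> c * p"
      using assms(3) that by simp
    then show ?thesis
      using levy_integral_pos[OF assms(4,5) that] assms(7)[of p] that by simp
  qed
  \<comment> \<open>The bound uses the midpoint because \<open>\<phi> 0 = \<kappa>\<close> may be
    0.\<close>
  have "0 < (q - q / 2) * \<phi> (q / 2)"
    using q gt[of "q / 2"] \<kappa> by simp
  also have "\<dots> \<le> integrated_exponent \<phi> q - integrated_exponent \<phi> (q / 2)"
    using q by (intro integrated_exponent_diff_bounds(1)[OF mono_exponent]) auto
  also have "\<dots> \<le> integrated_exponent \<phi> q"
  proof -
    have "0 \<le> (q / 2 - 0) * \<phi> 0"
      using q exponent_0 \<kappa> by (intro mult_nonneg_nonneg) auto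
    also have "\<dots> \<le> integrated_exponent \<phi> (q / 2) - integrated_exponent \<phi> 0"
      using q by (intro integrated_exponent_diff_bounds(1)[OF mono_exponent]) auto
    finally show ?thesis
      by (simp add: integrated_exponent_def)
  qed
  finally have \<Phi>: "0 < integrated_exponent \<phi> q" .
  define a where "a = exp (integrated_exponent \<phi> q / q) +
    2 * sqrt q * exp (9 * \<phi> q / 4) * sqrt (pi / integrated_exponent \<phi> q)"
  have a: "0 < a"
    unfolding a_def using q \<Phi> by (intro add_pos_nonneg) auto
  show "\<exists>a>0. \<forall>t\<ge>0. (\<integral>\<omega>. exp_neg q (value_at \<xi> (time_change \<xi> t) \<omega>) \<partial>M)
      \<le> a * (1 + t powr (1 / 8)) * exp (- 2 * sqrt (integrated_exponent \<phi> q * t))"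
  proof (intro exI[of _ a] conjI allI impI a)
    fix t :: real assume t: "0 \<le> t"
    have "(\<integral>\<omega>. exp_neg q (value_at \<xi> (time_change \<xi> t) \<omega>) \<partial>M)
        \<le> a * exp (- 2 * sqrt (integrated_exponent \<phi> q * t))"
      unfolding a_def using gt[of 1] by (intro integral_exp_neg_time_change_le \<xi> q \<Phi> t) auto
    \<comment> \<open>The inserted factor is at least 1.\<close>
    also have "\<dots> \<le> a * (1 + t powr (1 / 8)) * exp (- 2 * sqrt (integrated_exponent \<phi> q * t))"
      using a by (intro mult_right_mono) auto
    finally show "(\<integral>\<omega>. exp_neg q (value_at \<xi> (time_change \<xi> t) \<omega>) \<partial>M)
        \<le> a * (1 + t powr (1 / 8)) * exp (- 2 * sqrt (integrated_exponent \<phi> q * t))" .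
  qed
qed

end
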